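(* Let $S$ be a closed, densely defined symmetric operator on a separable Hilbert space $\mathcal H$ with equal (possibly infinite) defect numbers, and let $(\mathcal K,\Gamma_0,\Gamma_1)$ be a boundary triplet for $S$. For $z\in\mathbb C$ let $\mathcal M(z)=\{(\Gamma_0f,\Gamma_1f):f\in\ker(S^*-z)\}\subset\mathcal K\oplus\mathcal K$. Then in a neighborhood of any $z_0\in\Phi_-(S^* )$ there exists an analytic family of invertible operators $G_z\in\mathcal B(\mathcal K\oplus\mathcal K)$ such that $G_{z_0}=I_{\mathcal K\oplus\mathcal K}$ and $G_z\mathcal M(z_0)=\mathcal M(z)$.
   Context: All inner products are linear in the second argument. A boundary triplet $(\mathcal K,\Gamma_0,\Gamma_1)$ for $S$ consists of a (possibly infinite-dimensional) complex Hilbert space $\mathcal K$ and linear maps $\Gamma_0,\Gamma_1:\operatorname{dom}(S^* )\to\mathcal K$ such that $\mathbf\Gamma f:=(\Gamma_0f,\Gamma_1f)$ defines a surjection $\operatorname{dom}(S^* )\to\mathcal K\oplus\mathcal K$ and $\langle f,S^*g\rangle_{\mathcal H}-\langle S^*f,g\rangle_{\mathcal H}=\langle\Gamma_0f,\Gamma_1g\rangle_{\mathcal K}-\langle\Gamma_1f,\Gamma_0g\rangle_{\mathcal K}$ for all $f,g\in\operatorname{dom}(S^* )$. $\mathcal B(X)$ denotes the bounded linear operators on $X$. For a closed operator $T$ the deficiency $\operatorname{def}T$ is the codimension of $\operatorname{ran}T$ in the target space, and $\Phi_-(T):=\{z\in\mathbb C:\operatorname{def}(T-z)<\infty\}$.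 *)

theory Defs
  imports "HOL-Analysis.Analysis"
begin

section \<open>Complex Hilbert spaces\<close>

class complex_vector = real_vector +
  fixes scaleC :: "complex \<Rightarrow> 'a \<Rightarrow> 'a" (infixr "*\<^sub>C" 75)
  assumes scaleC_add_right: "a *\<^sub>C (x + y) = a *\<^sub>C x + a *\<^sub>C y"
    and scaleC_add_left: "(a + b) *\<^sub>C x = a *\<^sub>C x + b *\<^sub>C x"
    and scaleC_scaleC: "a *\<^sub>C b *\<^sub>C x = (a * b) *\<^sub>C x"
    and scaleC_of_real: "complex_of_real r *\<^sub>C x = r *\<^sub>R x"

class complex_normed_vector = complex_vector + real_normed_vector +
  assumes norm_scaleC: "norm (a *\<^sub>C x) = cmod a * norm x"

text \<open>The inner product is linear in the second argument. The underlying real inner product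
  (hence norm, metric and topology) is its real part, so \<open>norm x = sqrt (Re (cinner x x))\<close>.\<close>

class complex_inner = complex_normed_vector + real_inner +
  fixes cinner :: "'a \<Rightarrow> 'a \<Rightarrow> complex"
  assumes cinner_commute: "cinner x y = cnj (cinner y x)"
    and cinner_add_right: "cinner x (y + z) = cinner x y + cinner x z"
    and cinner_scaleC_right: "cinner x (a *\<^sub>C y) = a * cinner x y"
    and Re_cinner: "Re (cinner x y) = inner x y"

class chilbert_space = complex_inner + complete_space

lemma scaleC_one: "1 *\<^sub>C x = (x :: 'a :: complex_vector)"
  using scaleC_of_real[of 1 x] by simp

global_interpretation complex_vector: vector_space "scaleC :: complex \<Rightarrow> 'a \<Rightarrow> 'a :: complex_vector"
  defines csubspace = complex_vector.subspace
    and cspan = complex_vector.span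
  by unfold_locales (simp_all add: scaleC_add_right scaleC_add_left scaleC_scaleC scaleC_one)

text \<open>The product type with componentwise operations is the orthogonal sum of Hilbert spaces.\<close>

instantiation prod :: (complex_vector, complex_vector) complex_vector
begin
definition scaleC_prod_def: "scaleC a p = (a *\<^sub>C fst p, a *\<^sub>C snd p)"
instance
  by standard (simp_all add: scaleC_prod_def scaleC_add_right scaleC_add_left scaleC_scaleC
      scaleC_of_real scaleR_prod_def)
end

instance prod :: (complex_normed_vector, complex_normed_vector) complex_normed_vector
proof
  fix a :: complex and x :: "'a \<times> 'b"
  have "(cmod a * norm (fst x))\<^sup>2 + (cmod a * norm (snd x))\<^sup>2
      = (cmod a)\<^sup>2 * ((norm (fst x))\<^sup>2 + (norm (snd x))\<^sup>2)"
    by (simp add: power_mult_distrib distrib_left)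
  then show "norm (a *\<^sub>C x) = cmod a * norm x"
    by (simp add: norm_prod_def scaleC_prod_def norm_scaleC real_sqrt_mult)
qed

instantiation prod :: (complex_inner, complex_inner) complex_inner
begin
definition cinner_prod_def: "cinner p q = cinner (fst p) (fst q) + cinner (snd p) (snd q)"
instance
proof
  fix x y z :: "'a \<times> 'b" and a :: complex
  show "cinner x y = cnj (cinner y x)"
    unfolding cinner_prod_def
    by (subst cinner_commute[of "fst x"], subst cinner_commute[of "snd x"]) simp
  show "cinner x (y + z) = cinner x y + cinner x z"
    by (simp add: cinner_prod_def cinner_add_right)
  show "cinner x (a *\<^sub>C y) = a * cinner x y"
    by (simp add: cinner_prod_def scaleC_prod_def cinner_scaleC_right distrib_left)
  show "Re (cinner x y) = inner x y"
    by (simp add: cinner_prod_def inner_prod_def Re_cinner)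
qed
end

instance prod :: (chilbert_space, chilbert_space) chilbert_space ..


section \<open>Bounded operators and analytic families\<close>

instantiation blinfun :: (real_normed_vector, complex_normed_vector) complex_normed_vector
begin
lift_definition scaleC_blinfun :: "complex \<Rightarrow> 'a \<Rightarrow>\<^sub>L 'b \<Rightarrow> 'a \<Rightarrow>\<^sub>L 'b" is "\<lambda>a f x. a *\<^sub>C f x"
proof -
  fix a :: complex and f :: "'a \<Rightarrow> 'b"
  assume f: "bounded_linear f"
  then interpret bounded_linear f .
  obtain C where "\<And>x. norm (f x) \<le> norm x * C"
    using bounded by blast
  then have bd: "norm (a *\<^sub>C f x) \<le> norm x * (cmod a * C)" for x
    using mult_left_mono[of "norm (f x)" "norm x * C" "cmod a"]
    by (simp add: norm_scaleC mult_ac)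
  have sc: "a *\<^sub>C f (r *\<^sub>R x) = r *\<^sub>R (a *\<^sub>C f x)" for r x
    by (simp add: scaleR scaleC_of_real[symmetric] scaleC_scaleC mult.commute)
  show "bounded_linear (\<lambda>x. a *\<^sub>C f x)"
    by (rule bounded_linear_intro[of _ "cmod a * C"])
       (simp_all add: add scaleC_add_right sc bd)
qed
instance
proof
  fix a b :: complex and r :: real and x y :: "'a \<Rightarrow>\<^sub>L 'b"
  show "a *\<^sub>C (x + y) = a *\<^sub>C x + a *\<^sub>C y"
    by transfer (simp add: scaleC_add_right)
  show "(a + b) *\<^sub>C x = a *\<^sub>C x + b *\<^sub>C x"
    by transfer (simp add: scaleC_add_left)
  show "a *\<^sub>C b *\<^sub>C x = (a * b) *\<^sub>C x"
    by transfer (simp add: scaleC_scaleC)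
  show "complex_of_real r *\<^sub>C x = r *\<^sub>R x"
    by transfer (simp add: scaleC_of_real)
  show "norm (a *\<^sub>C x) = cmod a * norm x"
  proof transfer
    fix a :: complex and f :: "'a \<Rightarrow> 'b"
    assume "bounded_linear f"
    then have "onorm (\<lambda>x. cmod a *\<^sub>R f x) = \<bar>cmod a\<bar> * onorm f"
      by (rule onorm_scaleR)
    then show "onorm (\<lambda>x. a *\<^sub>C f x) = cmod a * onorm f"
      by (simp add: onorm_def norm_scaleC)
  qed
qed
end

text \<open>The library type of bounded linear functions only demands real linearity; \<open>\<B>(X)\<close> consists
  of its complex linear elements (with the operator norm).\<close>

definition bounded_ops :: "('a :: complex_normed_vector \<Rightarrow>\<^sub>L 'a) set"
  where "bounded_ops = {A. \<forall>c x. blinfun_apply A (c *\<^sub>C x) = c *\<^sub>C blinfun_apply A x}"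

definition invertible_op :: "('a :: complex_normed_vector \<Rightarrow>\<^sub>L 'a) \<Rightarrow> bool"
  where "invertible_op A \<longleftrightarrow>
    A \<in> bounded_ops \<and> (\<exists>B\<in>bounded_ops. B o\<^sub>L A = id_blinfun \<and> A o\<^sub>L B = id_blinfun)"

text \<open>Complex differentiability with respect to the norm at every point; the library's
  \<open>holomorphic_on\<close> covers only scalar-valued functions. Used for open \<open>U\<close>.\<close>

definition analytic_family_on :: "(complex \<Rightarrow> 'a :: complex_normed_vector) \<Rightarrow> complex set \<Rightarrow> bool"
  where "analytic_family_on F U \<longleftrightarrow>
    (\<forall>z\<in>U. \<exists>F'. (F has_derivative (\<lambda>h. h *\<^sub>C F')) (at z))"


section \<open>Unbounded operators\<close>

text \<open>An operator is a domain together with a map; only the values on the domain matter.\<close>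

type_synonym 'a lop = "'a set \<times> ('a \<Rightarrow> 'a)"

abbreviation op_dom :: "'a lop \<Rightarrow> 'a set"
  where "op_dom \<equiv> fst"

abbreviation op_app :: "'a lop \<Rightarrow> 'a \<Rightarrow> 'a"
  where "op_app \<equiv> snd"

definition clinear_on :: "'a :: complex_vector set \<Rightarrow> ('a \<Rightarrow> 'b :: complex_vector) \<Rightarrow> bool"
  where "clinear_on D f \<longleftrightarrow>
    (\<forall>x\<in>D. \<forall>y\<in>D. f (x + y) = f x + f y) \<and> (\<forall>c. \<forall>x\<in>D. f (c *\<^sub>C x) = c *\<^sub>C f x)"

definition linear_op :: "'a :: complex_vector lop \<Rightarrow> bool"
  where "linear_op T \<longleftrightarrow> csubspace (op_dom T) \<and> clinear_on (op_dom T) (op_app T)"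

definition closed_op :: "'a :: complex_normed_vector lop \<Rightarrow> bool"
  where "closed_op T \<longleftrightarrow> closed {(f, op_app T f) |f. f \<in> op_dom T}"

definition densely_defined :: "'a :: complex_normed_vector lop \<Rightarrow> bool"
  where "densely_defined T \<longleftrightarrow> closure (op_dom T) = UNIV"

definition symmetric_op :: "'a :: complex_inner lop \<Rightarrow> bool"
  where "symmetric_op T \<longleftrightarrow>
    (\<forall>f\<in>op_dom T. \<forall>g\<in>op_dom T. cinner f (op_app T g) = cinner (op_app T f) g)"

text \<open>For densely defined \<open>T\<close> the vector \<open>h\<close> below is unique, so the description is proper.\<close>

definition adj_op :: "'a :: complex_inner lop \<Rightarrow> 'a lop"
  where "adj_op T =
    ({g. \<exists>h. \<forall>f\<in>op_dom T. cinner g (op_app T f) = cinner h f},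
     \<lambda>g. THE h. \<forall>f\<in>op_dom T. cinner g (op_app T f) = cinner h f)"

definition shift_op :: "'a :: complex_vector lop \<Rightarrow> complex \<Rightarrow> 'a lop"
  where "shift_op T z = (op_dom T, \<lambda>f. op_app T f - z *\<^sub>C f)"

definition op_ker :: "'a :: complex_vector lop \<Rightarrow> 'a set"
  where "op_ker T = {f \<in> op_dom T. op_app T f = 0}"

definition op_ran :: "'a :: complex_vector lop \<Rightarrow> 'a set"
  where "op_ran T = op_app T ` op_dom T"


section \<open>Dimensions, defect numbers and deficiency\<close>

text \<open>Dimension and codimension of a subspace as the least number of vectors spanning the
  subspace, respectively spanning the whole space modulo the subspace; \<open>\<infinity>\<close> if no finite number
  suffices.\<close>

definition cdimension :: "'a :: complex_vector set \<Rightarrow> enat"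
  where "cdimension V = Inf {enat (card B) |B. finite B \<and> cspan B = V}"

definition codimension :: "'a :: complex_vector set \<Rightarrow> enat"
  where "codimension V = Inf {enat (card B) |B. finite B \<and> cspan (V \<union> B) = UNIV}"

text \<open>The closed subspaces \<open>ker (S* \<mp> \<i>)\<close> of a separable space have Hilbert dimension
  in \<open>\<nat> \<union> {\<infinity>}\<close>, which is what \<open>cdimension\<close> returns.\<close>

definition equal_defect_numbers :: "'a :: complex_inner lop \<Rightarrow> bool"
  where "equal_defect_numbers S \<longleftrightarrow>
    cdimension (op_ker (shift_op (adj_op S) \<i>)) = cdimension (op_ker (shift_op (adj_op S) (- \<i>)))"

definition deficiency :: "'a :: complex_vector lop \<Rightarrow> enat"
  where "deficiency T = codimension (op_ran T)"

definition Phi_minus :: "'a :: complex_vector lop \<Rightarrow> complex set"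
  where "Phi_minus T = {z. deficiency (shift_op T z) < \<infinity>}"


section \<open>Boundary triplets\<close>

definition boundary_triplet ::
    "'h :: chilbert_space lop \<Rightarrow> ('h \<Rightarrow> 'k :: chilbert_space) \<Rightarrow> ('h \<Rightarrow> 'k) \<Rightarrow> bool"
  where "boundary_triplet S \<Gamma>\<^sub>0 \<Gamma>\<^sub>1 \<longleftrightarrow>
    clinear_on (op_dom (adj_op S)) \<Gamma>\<^sub>0 \<and>
    clinear_on (op_dom (adj_op S)) \<Gamma>\<^sub>1 \<and>
    (\<lambda>f. (\<Gamma>\<^sub>0 f, \<Gamma>\<^sub>1 f)) ` op_dom (adj_op S) = UNIV \<and>
    (\<forall>f\<in>op_dom (adj_op S). \<forall>g\<in>op_dom (adj_op S).
      cinner f (op_app (adj_op S) g) - cinner (op_app (adj_op S) f) g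
        = cinner (\<Gamma>\<^sub>0 f) (\<Gamma>\<^sub>1 g) - cinner (\<Gamma>\<^sub>1 f) (\<Gamma>\<^sub>0 g))"

definition boundary_space ::
    "'h :: chilbert_space lop \<Rightarrow> ('h \<Rightarrow> 'k :: chilbert_space) \<Rightarrow> ('h \<Rightarrow> 'k) \<Rightarrow> complex \<Rightarrow> ('k \<times> 'k) set"
  where "boundary_space S \<Gamma>\<^sub>0 \<Gamma>\<^sub>1 z = {(\<Gamma>\<^sub>0 f, \<Gamma>\<^sub>1 f) |f. f \<in> op_ker (shift_op (adj_op S) z)}"

end

theory Submission
  imports Defs
begin

text \<open>Write \<open>T\<close> for the adjoint of \<open>S\<close>, \<open>A\<close> for the range of \<open>T - z\<^sub>0\<close>, which is closed because its
  codimension is finite, and \<open>L\<close> for the intersection of \<open>A\<close> with \<open>ker (T - z\<^sub>0)\<close>. The orthogonal complement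
  of \<open>A\<close> consists of eigenvectors of \<open>S\<close>; it lies in \<open>ker \<Gamma>\<close> and in \<open>ker (T - z\<^sub>0)\<close>, so \<open>\<Gamma>\<close> maps \<open>L\<close>
  onto the boundary space at \<open>z\<^sub>0\<close>. If \<open>R\<close> is the right inverse of \<open>T - z\<^sub>0\<close> on \<open>A\<close> with values orthogonal to
  \<open>ker (T - z\<^sub>0)\<close>, extended by \<open>0\<close>, then \<open>(1 - (z - z\<^sub>0) R)\<^sup>-\<^sup>1\<close> maps \<open>L\<close> onto \<open>ker (T - z)\<close> for \<open>z \<noteq> z\<^sub>0\<close> near
  \<open>z\<^sub>0\<close>. On \<open>L\<close> the map \<open>\<Gamma>\<close> is bounded below; hence its image is closed and there is a bounded \<open>E\<close> with
  \<open>E (\<Gamma> f) = f\<close> on \<open>L\<close>. Finally \<open>G z = 1 + (z - z\<^sub>0) (\<Gamma> R) (1 - (z - z\<^sub>0) R)\<^sup>-\<^sup>1 E\<close> works. Boundedness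
  of \<open>R\<close>, \<open>\<Gamma> R\<close> and \<open>E\<close> comes from the closed graph theorem.\<close>

section \<open>Closed relations between Banach spaces\<close>

instance chilbert_space \<subseteq> banach ..

text \<open>The open mapping theorem for a linear relation: Baire category gives approximate
  solutions of controlled norm, and successive correction makes them exact. In this form it serves
  the closed graph theorem, the closed range lemma and the choice of small preimages under
  \<Gamma>.\<close>

lemma open_mapping_closed_relation:
  fixes V :: "('a::banach \<times> 'b::banach) set"
  assumes V: "subspace V" "closed V" and surj: "fst ` V = UNIV"
  obtains C where "C \<ge> 0" "\<And>x. \<exists>y. (x, y) \<in> V \<and> norm y \<le> C * norm x"
proof -
  have Vadd: "(a + c, b + d) \<in> V" if "(a, b) \<in> V" "(c, d) \<in> V" for a b c d
    using subspace_add[OF V(1) that] by simp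
  have Vdiff: "(a - c, b - d) \<in> V" if "(a, b) \<in> V" "(c, d) \<in> V" for a b c d
    using subspace_diff[OF V(1) that] by simp
  have Vscale: "(r *\<^sub>R a, r *\<^sub>R b) \<in> V" if "(a, b) \<in> V" for a b r
    using subspace_scale[OF V(1) that, of r] by simp
  define B where "B n = {x. \<exists>y. (x, y) \<in> V \<and> norm y \<le> real n}" for n
  have cover: "(\<Union>n. B n) = UNIV"
  proof -
    have "\<exists>n. x \<in> B n" for x
    proof -
      obtain y where "(x, y) \<in> V"
        using surj by (metis UNIV_I imageE prod.collapse)
      moreover obtain n where "norm y \<le> real n"
        using real_arch_simple by blast
      ultimately show ?thesis
        by (auto simp: B_def)
    qed
    then show ?thesis by auto
  qed
  have "\<exists>n. interior (closure (B n)) \<noteq> {}"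
  proof (rule ccontr)
    assume *: "\<not> ?thesis"
    have "Met_TC.mtopology interior_of \<Union> (range (\<lambda>n. closure (B n))) = ({}::'a set)"
    proof (rule Met_TC.metric_Baire_category_alt)
      show "Met_TC.mcomplete TYPE('a)" for x :: 'a
        by (simp add: mcomplete_iff_complete complete_UNIV)
      show "countable (range (\<lambda>n. closure (B n)))"
        by simp
    qed (use * in auto)
    moreover have "\<Union> (range (\<lambda>n. closure (B n))) = UNIV"
      using cover closure_subset by blast
    ultimately show False by simp
  qed
  then obtain n x\<^sub>0 where "x\<^sub>0 \<in> interior (closure (B n))"
    by auto
  then obtain r where r: "r > 0" "ball x\<^sub>0 r \<subseteq> closure (B n)"
    by (meson mem_interior)
  \<comment> \<open>Subtracting two approximants moves the ball from \<open>x\<^sub>0\<close> to the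
    origin, at the price of doubling the bound \<open>n\<close>.\<close>
  have near: "\<exists>a y. (a, y) \<in> V \<and> norm y \<le> 2 * real n \<and> norm (x - a) < e"
    if "norm x < r" "e > 0" for x e
  proof -
    have "x\<^sub>0 + x \<in> closure (B n)" "x\<^sub>0 \<in> closure (B n)"
      using r that by (auto simp: subset_iff dist_norm)
    then obtain a b where a: "a \<in> B n" "dist a (x\<^sub>0 + x) < e/2" and b: "b \<in> B n" "dist b x\<^sub>0 < e/2"
      using \<open>e > 0\<close> by (meson closure_approachable half_gt_zero)
    then obtain y w where y: "(a, y) \<in> V" "norm y \<le> real n" and w: "(b, w) \<in> V" "norm w \<le> real n"
      by (auto simp: B_def)
    have "x - (a - b) = (x\<^sub>0 + x - a) + (b - x\<^sub>0)"
      by simp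
    then have "norm (x - (a - b)) \<le> norm (x\<^sub>0 + x - a) + norm (b - x\<^sub>0)"
      by (simp only: norm_triangle_ineq)
    then have "norm (x - (a - b)) < e"
      using a(2) b(2) unfolding dist_norm norm_minus_commute[of a] by linarith
    moreover have "norm (y - w) \<le> 2 * real n"
      using y w norm_triangle_ineq4[of y w] by linarith
    ultimately show ?thesis
      using Vdiff[OF y(1) w(1)] by blast
  qed
  \<comment> \<open>Scaling \<open>x\<close> to norm \<open>r / 2\<close> and approximating within
    \<open>r / 4\<close> leaves a residual of at most half the norm of \<open>x\<close>; undoing the
    scaling turns \<open>2 * real n\<close> into \<open>M * norm x\<close>.\<close>
  define M where "M = 4 * real n / r"
  have M: "M \<ge> 0" using r by (simp add: M_def)
  have step: "\<exists>p. p \<in> V \<and> norm (snd p) \<le> M * norm x \<and> norm (x - fst p) \<le> norm x / 2" for x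
  proof (cases "x = 0")
    case True
    then show ?thesis using subspace_0[OF V(1)] by (intro exI[of _ 0]) simp
  next
    case False
    define s where "s = r / (2 * norm x)"
    have s: "s > 0" using False r by (simp add: s_def)
    have sx: "norm (s *\<^sub>R x) = r / 2"
      using False s r by (simp add: s_def)
    then obtain a y where a: "(a, y) \<in> V" "norm y \<le> 2 * real n" "norm (s *\<^sub>R x - a) < r / 4"
      using near[of "s *\<^sub>R x" "r / 4"] r by auto
    have "norm (inverse s *\<^sub>R y) \<le> inverse s * (2 * real n)"
      using a s by simp
    also have "\<dots> = M * norm x"
      using False r by (simp add: s_def M_def field_simps)
    finally have 1: "norm (inverse s *\<^sub>R y) \<le> M * norm x" .
    have "norm (x - inverse s *\<^sub>R a) = norm (inverse s *\<^sub>R (s *\<^sub>R x - a))"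
      using s by (simp add: scaleR_diff_right)
    also have "\<dots> = inverse s * norm (s *\<^sub>R x - a)"
      using s by simp
    also have "\<dots> \<le> inverse s * (r / 4)"
      using a s by (intro mult_left_mono) auto
    also have "\<dots> = norm x / 2"
      using False r by (simp add: s_def field_simps)
    finally show ?thesis
      using 1 Vscale[OF a(1), of "inverse s"] by (intro exI[of _ "(inverse s *\<^sub>R a, inverse s *\<^sub>R y)"]) simp
  qed
  define p where "p x = (SOME p. p \<in> V \<and> norm (snd p) \<le> M * norm x \<and> norm (x - fst p) \<le> norm x / 2)" for x
  have p: "p x \<in> V" "norm (snd (p x)) \<le> M * norm x" "norm (x - fst (p x)) \<le> norm x / 2" for x
    using someI_ex[OF step[of x]] by (simp_all add: p_def)
  have "\<exists>y. (x, y) \<in> V \<and> norm y \<le> 2 * M * norm x" for x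
  proof -
    \<comment> \<open>\<open>X k\<close> is the residual after \<open>k\<close> corrections; the
      corrections telescope to \<open>x - X k\<close>, and closedness of \<open>V\<close> allows the
      passage to the limit.\<close>
    define X where "X k = ((\<lambda>x. x - fst (p x)) ^^ k) x" for k
    have X0: "X 0 = x" and XS: "X (Suc k) = X k - fst (p (X k))" for k
      by (simp_all add: X_def)
    have Xn: "norm (X k) \<le> norm x * (1/2) ^ k" for k
    proof (induction k)
      case (Suc k)
      have "norm (X (Suc k)) \<le> norm (X k) / 2"
        using p(3) by (simp add: XS)
      then show ?case using Suc by simp
    qed (simp add: X0)
    have yn: "norm (snd (p (X k))) \<le> M * norm x * (1/2) ^ k" for k
      using order_trans[OF p(2) mult_left_mono[OF Xn M]] by (simp add: mult.assoc)
    have geo: "summable (\<lambda>k. M * norm x * (1/2) ^ k)"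
      by (intro summable_mult summable_geometric) simp
    have summ: "summable (\<lambda>k. norm (snd (p (X k))))"
      by (rule summable_comparison_test'[OF geo]) (use yn in simp)
    define y where "y = (\<Sum>k. snd (p (X k)))"
    have "norm y \<le> (\<Sum>k. M * norm x * (1/2) ^ k)"
      unfolding y_def by (rule norm_suminf_le[OF yn geo])
    also have "\<dots> = 2 * M * norm x"
      using suminf_geometric[of "1/2::real"] by (subst suminf_mult) (auto intro: summable_geometric)
    finally have ny: "norm y \<le> 2 * M * norm x" .
    have partial: "(x - X k, \<Sum>i<k. snd (p (X i))) \<in> V" for k
    proof (induction k)
      case 0
      then show ?case using subspace_0[OF V(1)] by (simp add: X0 zero_prod_def)
    next
      case (Suc k)
      then show ?case
        using Vadd[OF Suc, of "fst (p (X k))" "snd (p (X k))"] p(1)[of "X k"] by (simp add: XS algebra_simps)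
    qed
    have "(\<lambda>k. norm x * (1/2) ^ k) \<longlonglongrightarrow> norm x * 0"
      by (intro tendsto_intros) (auto intro: LIMSEQ_realpow_zero)
    then have "(\<lambda>k. norm x * (1/2) ^ k) \<longlonglongrightarrow> 0"
      by simp
    then have "X \<longlonglongrightarrow> 0"
      by (rule Lim_null_comparison[rotated]) (simp add: Xn)
    then have "(\<lambda>k. x - X k) \<longlonglongrightarrow> x - 0"
      by (intro tendsto_intros)
    moreover have "(\<lambda>k. \<Sum>i<k. snd (p (X i))) \<longlonglongrightarrow> y"
      unfolding y_def using summable_norm_cancel[OF summ] by (rule summable_LIMSEQ)
    ultimately have "(\<lambda>k. (x - X k, \<Sum>i<k. snd (p (X i)))) \<longlonglongrightarrow> (x - 0, y)"
      by (rule tendsto_Pair)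
    then have "(x - 0, y) \<in> V"
      by (rule closed_sequentially[OF V(2) partial])
    then show ?thesis using ny by (intro exI[of _ y]) simp
  qed
  then show thesis
    using that[of "2 * M"] M by simp
qed

section \<open>Complex scalars, complex inner products and the closed graph theorem\<close>

lemma scaleC_zero_left [simp]: "0 *\<^sub>C (x::'a::complex_vector) = 0"
  and scaleC_zero_right [simp]: "c *\<^sub>C (0::'a::complex_vector) = 0"
  and scaleC_minus_right: "c *\<^sub>C (- x) = - (c *\<^sub>C x)"
  and scaleC_diff_right: "c *\<^sub>C (x - y) = c *\<^sub>C x - c *\<^sub>C y"
  and scaleC_diff_left: "(c - d) *\<^sub>C x = c *\<^sub>C x - d *\<^sub>C x"
  by (simp_all add: complex_vector.scale_left_diff_distrib complex_vector.scale_right_diff_distrib)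

lemma scaleC_Pair [simp]: "c *\<^sub>C (x, y) = (c *\<^sub>C x, c *\<^sub>C y)"
  by (simp add: scaleC_prod_def)

lemma csubspace_imp_subspace: "csubspace V \<Longrightarrow> subspace V"
  unfolding complex_vector.subspace_def subspace_def
  by (metis scaleC_of_real)

lemma bounded_linear_scaleC: "bounded_linear (\<lambda>x :: 'a::complex_normed_vector. c *\<^sub>C x)"
proof (rule bounded_linear_intro)
  show "c *\<^sub>C (r *\<^sub>R x) = r *\<^sub>R (c *\<^sub>C x)" for r and x :: 'a
    by (simp add: scaleC_of_real[symmetric] scaleC_scaleC mult.commute)
  show "norm (c *\<^sub>C x) \<le> norm x * cmod c" for x :: 'a
    by (simp add: norm_scaleC)
qed (rule scaleC_add_right)

lemmas continuous_on_scaleC [continuous_intros] =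
  bounded_linear.continuous_on[OF bounded_linear_scaleC]
lemmas tendsto_scaleC [tendsto_intros] =
  bounded_linear.tendsto[OF bounded_linear_scaleC]

text \<open>The imaginary part of a number is minus the real part of its product with \<i>, and \<i>
  can be moved into the second argument. Continuity of \<open>cinner\<close> thus reduces to that of
  the real inner product.\<close>

lemma cinner_eq: "cinner x y = Complex (inner x y) (- inner x (\<i> *\<^sub>C y))"
proof -
  have "inner x (\<i> *\<^sub>C y) = Re (\<i> * cinner x y)"
    by (simp only: Re_cinner[symmetric] cinner_scaleC_right)
  then show ?thesis
    by (simp add: complex_eq_iff Re_cinner)
qed

lemma continuous_on_cinner [continuous_intros]:
  assumes "continuous_on A f" "continuous_on A g"
  shows "continuous_on A (\<lambda>x. cinner (f x) (g x))"
  unfolding cinner_eq Complex_eq by (intro continuous_intros assms)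

lemma cinner_add_left: "cinner (x + y) z = cinner x z + cinner y z"
  by (subst (1 2 3) cinner_commute) (simp add: cinner_add_right)

lemma cinner_scaleC_left: "cinner (a *\<^sub>C x) y = cnj a * cinner x y"
  by (subst (1 2) cinner_commute) (simp add: cinner_scaleC_right)

lemma cinner_zero [simp]: "cinner 0 x = 0" "cinner x 0 = 0"
  using cinner_add_left[of 0 0 x] cinner_add_right[of x 0 0] by simp_all

lemma cinner_diff_right: "cinner x (y - z) = cinner x y - cinner x z"
  using cinner_add_right[of x "y - z" z] by simp

lemma cinner_diff_left: "cinner (x - y) z = cinner x z - cinner y z"
  using cinner_add_left[of "x - y" y z] by simp

lemma cinner_self_eq_0 [simp]: "cinner x x = 0 \<longleftrightarrow> x = 0"
  by (metis Re_cinner cinner_zero(1) inner_eq_zero_iff zero_complex.sel(1))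

lemma cinner_eq_0_sym: "cinner x y = 0 \<longleftrightarrow> cinner y x = 0"
  by (metis cinner_commute complex_cnj_zero_iff)

lemma closed_Collect_ball:
  assumes "\<And>m. m \<in> M \<Longrightarrow> closed {x. P m x}"
  shows "closed {x. \<forall>m\<in>M. P m x}"
proof -
  have "{x. \<forall>m\<in>M. P m x} = (\<Inter>m\<in>M. {x. P m x})"
    by auto
  then show ?thesis
    using assms by auto
qed

text \<open>The closed graph theorem with the graph as the datum. Projections, Neumann inverses and
  the operators \<open>R\<close>, \<open>Q\<close>, \<open>E\<close> below are all specified by
  closed linear conditions on pairs, so that their boundedness comes from here.\<close>

lemma cclosed_graph:
  fixes V :: "('a::{complex_normed_vector,banach} \<times> 'b::{complex_normed_vector,banach}) set"
  assumes V: "csubspace V" "closed V" and ex1: "\<And>x. \<exists>!y. (x, y) \<in> V"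
  obtains F :: "'a \<Rightarrow>\<^sub>L 'b" where "clinear_on UNIV F" "\<And>x y. (x, y) \<in> V \<longleftrightarrow> y = F x"
proof -
  define f where "f x = (THE y. (x, y) \<in> V)" for x
  have f: "(x, y) \<in> V \<longleftrightarrow> y = f x" for x y
    using ex1[of x] theI'[OF ex1[of x]] by (auto simp: f_def)
  have add: "f (x + y) = f x + f y" for x y
    using complex_vector.subspace_add[OF V(1), of "(x, f x)" "(y, f y)"] by (simp add: f)
  have sc: "f (c *\<^sub>C x) = c *\<^sub>C f x" for c x
    using complex_vector.subspace_scale[OF V(1), of "(x, f x)" c] by (simp add: f)
  obtain C where C: "\<And>x. \<exists>y. (x, y) \<in> V \<and> norm y \<le> C * norm x"
  proof (rule open_mapping_closed_relation[OF csubspace_imp_subspace[OF V(1)] V(2)])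
    show "fst ` V = UNIV"
      using ex1 by (metis UNIV_eq_I fst_conv image_eqI)
  qed blast
  have "bounded_linear f"
  proof (rule bounded_linear_intro)
    show "f (r *\<^sub>R x) = r *\<^sub>R f x" for r x
      using sc[of "complex_of_real r"] by (simp add: scaleC_of_real)
    show "norm (f x) \<le> norm x * C" for x
      using C[of x] by (simp add: f mult.commute)
  qed (rule add)
  then show thesis
    using that[of "Blinfun f"] add sc f by (simp add: bounded_linear_Blinfun_apply clinear_on_def)
qed

lemma bounded_linear_scaleC_left: "bounded_linear (\<lambda>c. c *\<^sub>C (x :: 'a::complex_normed_vector))"
proof (rule bounded_linear_intro)
  show "(r *\<^sub>R c) *\<^sub>C x = r *\<^sub>R (c *\<^sub>C x)" for r c
    by (simp add: scaleC_of_real[symmetric] scaleC_scaleC scaleR_conv_of_real)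
  show "norm (c *\<^sub>C x) \<le> norm c * norm x" for c
    by (simp add: norm_scaleC)
qed (rule scaleC_add_left)

lemma closed_Collect_mem:
  fixes f :: "'b::t2_space \<Rightarrow> 'a::topological_space"
  assumes "closed S" "continuous_on UNIV f"
  shows "closed {x. f x \<in> S}"
  using continuous_closed_vimage[of S f] assms
  by (simp add: vimage_def continuous_on_eq_continuous_at)

section \<open>Orthogonal projections and closed ranges\<close>

text \<open>A minimizing sequence is Cauchy by the parallelogram law, since midpoints of its members
  stay in \<open>M\<close>.\<close>

lemma nearest_point_exists:
  fixes M :: "'a::chilbert_space set"
  assumes M: "subspace M" "closed M"
  obtains p where "p \<in> M" "\<And>m. m \<in> M \<Longrightarrow> norm (x - p) \<le> norm (x - m)"
proof -
  define d where "d = (INF m\<in>M. (norm (x - m))\<^sup>2)"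
  have ne: "M \<noteq> {}" using subspace_0[OF M(1)] by blast
  have bdd: "bdd_below ((\<lambda>m. (norm (x - m))\<^sup>2) ` M)"
    by (rule bdd_belowI[of _ 0]) auto
  have d_le: "d \<le> (norm (x - m))\<^sup>2" if "m \<in> M" for m
    unfolding d_def by (rule cINF_lower[OF bdd that])
  have "\<exists>m\<in>M. (norm (x - m))\<^sup>2 < d + 1 / real (Suc n)" for n
    using cINF_less_iff[OF ne bdd, of "d + 1 / real (Suc n)"] by (simp add: d_def)
  then obtain s where sM: "\<And>n. s n \<in> M" and s: "\<And>n. (norm (x - s n))\<^sup>2 < d + 1 / real (Suc n)"
    by metis
  have par: "(norm (s i - s j))\<^sup>2 \<le> 2 / real (Suc i) + 2 / real (Suc j)" for i j
  proof -
    define q where "q = (1/2) *\<^sub>R (s i + s j)"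
    have "q \<in> M"
      unfolding q_def by (intro subspace_scale subspace_add M(1) sM)
    have "(norm (s i - s j))\<^sup>2 = 2 * (norm (x - s i))\<^sup>2 + 2 * (norm (x - s j))\<^sup>2 - 4 * (norm (x - q))\<^sup>2"
      by (simp add: q_def power2_norm_eq_inner inner_simps inner_commute algebra_simps)
    then show ?thesis
      using d_le[OF \<open>q \<in> M\<close>] s[of i] s[of j] by simp
  qed
  have "Cauchy s"
  proof (rule metric_CauchyI)
    fix e :: real assume "e > 0"
    then obtain N where N: "inverse (real (Suc N)) < e\<^sup>2 / 4"
      using reals_Archimedean[of "e\<^sup>2 / 4"] by auto
    show "\<exists>N. \<forall>m\<ge>N. \<forall>n\<ge>N. dist (s m) (s n) < e"
    proof (intro exI allI impI)
      fix m n assume "m \<ge> N" "n \<ge> N"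
      then have "1 / real (Suc m) \<le> 1 / real (Suc N)" "1 / real (Suc n) \<le> 1 / real (Suc N)"
        by (simp_all add: frac_le)
      then have "(norm (s m - s n))\<^sup>2 < e\<^sup>2"
        using par[of m n] N by (simp add: inverse_eq_divide)
      then show "dist (s m) (s n) < e"
        using \<open>e > 0\<close> by (simp add: dist_norm power_less_imp_less_base)
    qed
  qed
  then obtain p where p: "s \<longlonglongrightarrow> p"
    using Cauchy_convergent convergent_def by blast
  then have "p \<in> M"
    by (rule closed_sequentially[OF M(2) sM])
  have "(norm (x - p))\<^sup>2 \<le> d"
  proof (rule LIMSEQ_le)
    show "(\<lambda>n. (norm (x - s n))\<^sup>2) \<longlonglongrightarrow> (norm (x - p))\<^sup>2"
      by (intro tendsto_intros p)
    have "(\<lambda>n. d + inverse (real (Suc n))) \<longlonglongrightarrow> d + 0"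
      by (intro tendsto_intros LIMSEQ_inverse_real_of_nat)
    then show "(\<lambda>n. d + 1 / real (Suc n)) \<longlonglongrightarrow> d"
      by (simp add: inverse_eq_divide)
    show "\<exists>N. \<forall>n\<ge>N. (norm (x - s n))\<^sup>2 \<le> d + 1 / real (Suc n)"
      using s by (intro exI[of _ 0] allI impI less_imp_le)
  qed
  then have "norm (x - p) \<le> norm (x - m)" if "m \<in> M" for m
    using d_le[OF that] by (meson norm_ge_zero order_trans power2_le_imp_le)
  then show thesis
    using that \<open>p \<in> M\<close> by blast
qed

text \<open>The nearest point is the foot of the perpendicular: moving it along \<open>m\<close>
  cannot shorten the distance, so the real inner product vanishes; testing with
  \<open>\<i> *\<^sub>C m\<close> removes the imaginary part.\<close>

lemma orthogonal_decomposition: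
  fixes M :: "'a::chilbert_space set"
  assumes M: "csubspace M" "closed M"
  obtains p where "p \<in> M" "\<And>m. m \<in> M \<Longrightarrow> cinner m (x - p) = 0"
proof -
  obtain p where p: "p \<in> M" "\<And>m. m \<in> M \<Longrightarrow> norm (x - p) \<le> norm (x - m)"
    using nearest_point_exists[OF csubspace_imp_subspace[OF M(1)] M(2)] by blast
  have inner0: "inner m (x - p) = 0" if "m \<in> M" for m
  proof (cases "m = 0")
    case False
    \<comment> \<open>\<open>t\<close> minimizes the quadratic polynomial given by the squared norm
      of \<open>(x - p) - t *\<^sub>R m\<close>.\<close>
    define t where "t = inner m (x - p) / inner m m"
    have "p + t *\<^sub>R m \<in> M"
      using p(1) that subspace_add subspace_scale csubspace_imp_subspace[OF M(1)] by blast
    then have "(norm (x - p))\<^sup>2 \<le> (norm ((x - p) - t *\<^sub>R m))\<^sup>2"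
      using p(2) by (simp add: diff_diff_eq)
    also have "\<dots> = (norm (x - p))\<^sup>2 - 2 * t * inner m (x - p) + t * (t * inner m m)"
      unfolding power2_norm_eq_inner inner_diff_left[of "x - p"] inner_diff_right[of _ "x - p"]
        inner_scaleR_left inner_scaleR_right inner_commute[of "x - p" m]
      by (simp add: right_diff_distrib)
    also have "\<dots> = (norm (x - p))\<^sup>2 - (inner m (x - p))\<^sup>2 / inner m m"
      using False by (simp add: t_def power2_eq_square)
    finally have "(inner m (x - p))\<^sup>2 / inner m m \<le> 0"
      by simp
    moreover have "0 < inner m m"
      using False by simp
    ultimately have "(inner m (x - p))\<^sup>2 \<le> 0 * inner m m"
      by (simp only: pos_divide_le_eq)
    then show ?thesis by simp
  qed simp
  have "cinner m (x - p) = 0" if "m \<in> M" for m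
  proof -
    have "Im (cinner m (x - p)) = inner (\<i> *\<^sub>C m) (x - p)"
      by (simp flip: Re_cinner add: cinner_scaleC_left)
    then show ?thesis
      using inner0[OF that] inner0[OF complex_vector.subspace_scale[OF M(1) that]]
      by (simp add: complex_eq_iff Re_cinner)
  qed
  then show thesis
    using that p(1) by blast
qed

text \<open>The pairs \<open>(x, p)\<close> with \<open>p\<close> in \<open>M\<close> and
  \<open>x - p\<close> orthogonal to \<open>M\<close> form a closed subspace, so linearity and
  boundedness come from the closed graph theorem.\<close>

lemma orthogonal_projection:
  fixes M :: "'a::chilbert_space set"
  assumes M: "csubspace M" "closed M"
  obtains P :: "'a \<Rightarrow>\<^sub>L 'a" where "clinear_on UNIV P" "\<And>x. P x \<in> M"
    "\<And>x m. m \<in> M \<Longrightarrow> cinner m (x - P x) = 0" "\<And>x. x \<in> M \<Longrightarrow> P x = x"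
proof -
  define V where "V = {v. snd v \<in> M \<and> (\<forall>m\<in>M. cinner m (fst v - snd v) = 0)}"
  have uniq: "p = q" if "(x, p) \<in> V" "(x, q) \<in> V" for x p q
  proof -
    have "p - q \<in> M"
      using that complex_vector.subspace_diff[OF M(1)] by (simp add: V_def)
    then have "cinner (p - q) ((x - q) - (x - p)) = 0"
      using that by (subst cinner_diff_right) (simp add: V_def)
    then show ?thesis by simp
  qed
  have "csubspace V"
    unfolding complex_vector.subspace_def V_def
    using M(1)[unfolded complex_vector.subspace_def]
    by (auto simp: scaleC_prod_def add_diff_add cinner_add_right cinner_scaleC_right
        simp flip: scaleC_diff_right)
  moreover have "closed V"
    unfolding V_def
    by (intro closed_Collect_conj closed_Collect_ball closed_Collect_eq
        closed_Collect_mem[OF M(2)] continuous_intros)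
  moreover have "\<exists>!y. (x, y) \<in> V" for x
  proof -
    obtain p where "p \<in> M" "\<And>m. m \<in> M \<Longrightarrow> cinner m (x - p) = 0"
      using orthogonal_decomposition[OF M] by blast
    then have "(x, p) \<in> V"
      by (simp add: V_def)
    then show ?thesis
      using uniq by (intro ex1I[of _ p])
  qed
  ultimately obtain P :: "'a \<Rightarrow>\<^sub>L 'a" where P: "clinear_on UNIV P" "\<And>x y. (x, y) \<in> V \<longleftrightarrow> y = P x"
    by (rule cclosed_graph) blast
  have "(x, P x) \<in> V" for x
    using P(2) by simp
  moreover have "P x = x" if "x \<in> M" for x
    using that P(2)[of x x] by (simp add: V_def)
  ultimately show thesis
    using that[OF P(1)] by (simp add: V_def)
qed

text \<open>Induction: once the new vector \<open>b\<close> is replaced by its part \<open>c\<close>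
  orthogonal to the old span, the coefficient of \<open>c\<close> is continuous and the new span is
  a continuous preimage of the old one.\<close>

lemma closed_cspan_finite:
  fixes B :: "'a::chilbert_space set"
  assumes "finite B"
  shows "closed (cspan B)"
  using assms
proof induction
  case empty
  then show ?case by simp
next
  case (insert b B)
  obtain p where p: "p \<in> cspan B" "\<And>m. m \<in> cspan B \<Longrightarrow> cinner m (b - p) = 0"
    using orthogonal_decomposition[OF complex_vector.subspace_span insert.IH] by blast
  define c where "c = b - p"
  have orth: "cinner c m = 0" if "m \<in> cspan B" for m
    using p(2)[OF that] by (simp add: c_def cinner_eq_0_sym)
  show ?case
  proof (cases "c = 0")
    case True
    then show ?thesis
      using insert.IH p(1) by (simp add: c_def complex_vector.span_redundant)
  next
    case False
    define coef where "coef x = cinner c x / cinner c c" for x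
    have "cspan (insert b B) = {x. x - coef x *\<^sub>C c \<in> cspan B}"
    proof (intro set_eqI iffI CollectI)
      fix x assume "x \<in> cspan (insert b B)"
      then obtain k where k: "x - k *\<^sub>C b \<in> cspan B"
        by (auto simp: complex_vector.span_insert)
      have x: "x = (x - k *\<^sub>C b + k *\<^sub>C p) + k *\<^sub>C c"
        by (simp add: c_def scaleC_diff_right)
      have mem: "x - k *\<^sub>C b + k *\<^sub>C p \<in> cspan B"
        by (intro complex_vector.span_add complex_vector.span_scale k p(1))
      have "cinner c x = k * cinner c c"
        by (subst x) (simp only: cinner_add_right[of c "x - k *\<^sub>C b + k *\<^sub>C p"] orth[OF mem] cinner_scaleC_right add_0)
      then have "coef x = k"
        using False by (simp add: coef_def)
      then show "x - coef x *\<^sub>C c \<in> cspan B"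
        using mem by (simp add: c_def scaleC_diff_right algebra_simps)
    next
      fix x assume "x \<in> {x. x - coef x *\<^sub>C c \<in> cspan B}"
      then have "x - coef x *\<^sub>C c - coef x *\<^sub>C p \<in> cspan B"
        using complex_vector.span_diff complex_vector.span_scale p(1) by blast
      then show "x \<in> cspan (insert b B)"
        by (auto simp: complex_vector.span_insert c_def scaleC_diff_right intro!: exI[of _ "coef x"])
    qed
    moreover have "closed {x. x - coef x *\<^sub>C c \<in> cspan B}"
      unfolding coef_def using False
      by (intro closed_Collect_mem[OF insert.IH] continuous_intros
          bounded_linear.continuous_on[OF bounded_linear_scaleC_left]) simp
    ultimately show ?thesis by simp
  qed
qed

text \<open>The graph of the inverse of \<open>1 - A\<close> is written down directly; Banach's
  fixed point theorem for \<open>\<lambda>y. x + A y\<close> shows that it is the graph of a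
  function.\<close>

lemma Neumann_inverse:
  fixes A :: "'a::{complex_normed_vector,banach} \<Rightarrow>\<^sub>L 'a"
  assumes A: "A \<in> bounded_ops" "norm A < 1"
  obtains B where "B \<in> bounded_ops" "\<And>x. B x - A (B x) = x" "\<And>x. B (x - A x) = x"
    "norm B \<le> 1 / (1 - norm A)"
proof -
  have Ac: "A (c *\<^sub>C x) = c *\<^sub>C A x" for c x
    using A(1) by (simp add: bounded_ops_def)
  define V where "V = {v. snd v - A (snd v) = fst v}"
  have "csubspace V"
    by (simp add: complex_vector.subspace_def V_def scaleC_prod_def blinfun.add_right Ac
        add_diff_add blinfun.zero_right flip: scaleC_diff_right)
  moreover have "closed V"
    unfolding V_def by (intro closed_Collect_eq continuous_intros)
  moreover have "\<exists>!y. (x, y) \<in> V" for x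
  proof -
    have "\<exists>!y. x + A y = y"
    proof (rule banach_fix_type)
      show "\<forall>y z. dist (x + A y) (x + A z) \<le> norm A * dist y z"
        by (simp add: dist_norm norm_blinfun flip: blinfun.diff_right)
    qed (use A(2) in auto)
    moreover have "(x, y) \<in> V \<longleftrightarrow> x + A y = y" for y
      by (simp add: V_def diff_eq_eq eq_commute[of y])
    ultimately show ?thesis by simp
  qed
  ultimately obtain B :: "'a \<Rightarrow>\<^sub>L 'a" where B: "clinear_on UNIV B" "\<And>x y. (x, y) \<in> V \<longleftrightarrow> y = B x"
    by (rule cclosed_graph) blast
  have right: "B x - A (B x) = x" for x
    using B(2)[of x "B x"] by (simp add: V_def)
  have "norm B \<le> 1 / (1 - norm A)"
  proof (rule norm_blinfun_bound)
    fix x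
    have "norm (B x) \<le> norm x + norm (A (B x))"
      using norm_triangle_sub[of "B x" "A (B x)"] right[of x] by simp
    also have "\<dots> \<le> norm x + norm A * norm (B x)"
      using norm_blinfun[of A "B x"] by simp
    finally show "norm (B x) \<le> 1 / (1 - norm A) * norm x"
      using A(2) by (simp add: field_simps)
  qed (use A(2) in simp)
  moreover have "B (x - A x) = x" for x
    using B(2)[of "x - A x" x] by (simp add: V_def)
  moreover have "B \<in> bounded_ops"
    using B(1) by (simp add: bounded_ops_def clinear_on_def)
  ultimately show thesis
    using that right by blast
qed

section \<open>Ranges of finite codimension\<close>

lemma csubspace_fst_image: "csubspace V \<Longrightarrow> csubspace (fst ` V)"
proof -
  assume V: "csubspace V"
  have "x + y \<in> fst ` V" if "x \<in> fst ` V" "y \<in> fst ` V" for x y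
    using that complex_vector.subspace_add[OF V] by (force intro: rev_image_eqI)
  moreover have "c *\<^sub>C x \<in> fst ` V" if "x \<in> fst ` V" for c x
    using that complex_vector.subspace_scale[OF V] by (force simp: scaleC_prod_def intro: rev_image_eqI)
  moreover have "0 \<in> fst ` V"
    using complex_vector.subspace_0[OF V] by (force intro: rev_image_eqI)
  ultimately show ?thesis
    by (simp add: complex_vector.subspace_def)
qed

text \<open>A set \<open>C\<close> of least cardinality works: a nonzero vector of \<open>A\<close>
  in its span could be exchanged for an element of \<open>C\<close>, leaving a smaller set.\<close>

lemma finite_complement_exists:
  assumes A: "csubspace A" and B: "finite B" "cspan (A \<union> B) = UNIV"
  obtains C where "finite C" "cspan (A \<union> C) = UNIV" "\<And>x. x \<in> A \<Longrightarrow> x \<in> cspan C \<Longrightarrow> x = 0"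
proof -
  have "\<exists>C. (finite C \<and> cspan (A \<union> C) = UNIV) \<and>
      (\<forall>C'. finite C' \<and> cspan (A \<union> C') = UNIV \<longrightarrow> card C \<le> card C')"
    by (rule ex_has_least_nat[of _ B]) (use B in simp)
  then obtain C where C: "finite C" "cspan (A \<union> C) = UNIV"
    and Cmin: "\<And>C'. finite C' \<Longrightarrow> cspan (A \<union> C') = UNIV \<Longrightarrow> card C \<le> card C'"
    by auto
  have "x = 0" if "x \<in> A" "x \<in> cspan C" for x
  proof (rule ccontr)
    assume "x \<noteq> 0"
    \<comment> \<open>If \<open>C'\<close> is least with \<open>x\<close> in its span, then
      \<open>x\<close> depends on each \<open>b\<close> in \<open>C'\<close>, and \<open>b\<close>
      lies in the span of \<open>x\<close> and the other elements.\<close>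
    have "\<exists>C'. (C' \<subseteq> C \<and> x \<in> cspan C') \<and> (\<forall>C''. C'' \<subseteq> C \<and> x \<in> cspan C'' \<longrightarrow> card C' \<le> card C'')"
      by (rule ex_has_least_nat[of _ C]) (use that in simp)
    then obtain C' where C': "C' \<subseteq> C" "x \<in> cspan C'"
      and C'min: "\<And>C''. C'' \<subseteq> C \<Longrightarrow> x \<in> cspan C'' \<Longrightarrow> card C' \<le> card C''"
      by auto
    have "C' \<noteq> {}"
      using C'(2) \<open>x \<noteq> 0\<close> by auto
    then obtain b where b: "b \<in> C'" by blast
    have "card (C' - {b}) < card C'"
      using b C' C(1) by (meson card_Diff1_less finite_subset)
    then have "x \<notin> cspan (C' - {b})"
      using C'min[of "C' - {b}"] C' by force
    then have "b \<in> cspan (insert x (C' - {b}))"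
      using complex_vector.in_span_delete[OF C'(2)] by blast
    also have "\<dots> \<subseteq> cspan (A \<union> (C - {b}))"
      using C'(1) that(1) by (intro complex_vector.span_mono) auto
    finally have "A \<union> C \<subseteq> cspan (A \<union> (C - {b}))"
      by (auto intro: complex_vector.span_base)
    then have "cspan (A \<union> (C - {b})) = UNIV"
      using complex_vector.span_minimal[OF _ complex_vector.subspace_span] C(2) by blast
    then have "card C \<le> card (C - {b})"
      using Cmin C(1) by blast
    then show False
      using card_Diff1_less[of C b] b C'(1) C(1) by auto
  qed
  then show thesis
    using that C by blast
qed

text \<open>A finite-dimensional complement makes the first projection surjective, so the open
  mapping bound applies. Since the sum is direct, the bound controls the complementary component,
  which therefore vanishes for limits of points of the range.\<close>

lemma closed_range_finite_codimension:
  fixes V :: "('a::chilbert_space \<times> 'b::{complex_normed_vector,banach}) set"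
  assumes V: "csubspace V" "closed V" and B: "finite B" "cspan (fst ` V \<union> B) = UNIV"
  shows "closed (fst ` V)"
proof -
  let ?A = "fst ` V"
  have A: "csubspace ?A" by (rule csubspace_fst_image[OF V(1)])
  obtain C where C: "finite C" "cspan (?A \<union> C) = UNIV" "\<And>x. x \<in> ?A \<Longrightarrow> x \<in> cspan C \<Longrightarrow> x = 0"
    using finite_complement_exists[OF A B] by blast
  have F: "csubspace (cspan C)" "closed (cspan C)"
    by (rule complex_vector.subspace_span, rule closed_cspan_finite[OF C(1)])
  have split: "\<exists>a f. x = a + f \<and> a \<in> ?A \<and> f \<in> cspan C" for x
  proof -
    have "x \<in> cspan (?A \<union> C)" using C(2) by simp
    moreover have "cspan ?A = ?A"
      using A by (simp only: complex_vector.span_eq_iff)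
    ultimately show ?thesis
      unfolding complex_vector.span_Un by auto
  qed
  \<comment> \<open>Elements of \<open>W\<close> are \<open>(a + f, y, f)\<close> with
    \<open>(a, y)\<close> in \<open>V\<close> and \<open>f\<close> in the complement; recording
    \<open>f\<close> makes the norm bound apply to it.\<close>
  define W where "W = {w :: 'a \<times> 'b \<times> 'a. snd (snd w) \<in> cspan C \<and> (fst w - snd (snd w), fst (snd w)) \<in> V}"
  have "csubspace W"
    using complex_vector.subspace_add[OF F(1)] complex_vector.subspace_scale[OF F(1)]
      complex_vector.subspace_add[OF V(1)] complex_vector.subspace_scale[OF V(1)]
      complex_vector.subspace_0[OF F(1)] complex_vector.subspace_0[OF V(1)]
    unfolding complex_vector.subspace_def W_def
    by (fastforce simp: scaleC_prod_def add_diff_add zero_prod_def simp flip: scaleC_diff_right)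
  moreover have "closed W"
    unfolding W_def
    by (intro closed_Collect_conj closed_Collect_mem[OF F(2)] closed_Collect_mem[OF V(2)] continuous_intros)
  moreover have "fst ` W = UNIV"
  proof -
    have "x \<in> fst ` W" for x
    proof -
      obtain a f where af: "x = a + f" "a \<in> ?A" "f \<in> cspan C"
        using split by blast
      then obtain y where "(a, y) \<in> V" by force
      then have "(x, y, f) \<in> W"
        using af by (simp add: W_def)
      then show ?thesis by (rule rev_image_eqI) simp
    qed
    then show ?thesis by blast
  qed
  ultimately obtain c where c: "c \<ge> 0" "\<And>x. \<exists>y. (x, y) \<in> W \<and> norm y \<le> c * norm x"
    using open_mapping_closed_relation[of W] csubspace_imp_subspace by blast
  show ?thesis
    unfolding closed_sequential_limits
  proof (intro allI impI, elim conjE)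
    fix s x assume sA: "\<forall>n. s n \<in> ?A" and s: "s \<longlonglongrightarrow> x"
    obtain a f where af: "x = a + f" "a \<in> ?A" "f \<in> cspan C"
      using split by blast
    \<comment> \<open>The complementary component of \<open>s n - x\<close> is \<open>- f\<close>
      for every \<open>n\<close>, so \<open>f\<close> is bounded by a quantity tending to
      zero.\<close>
    have "norm f \<le> c * norm (s n - x)" for n
    proof -
      obtain y g where yg: "(s n - x, y, g) \<in> W" "norm (y, g) \<le> c * norm (s n - x)"
        using c(2)[of "s n - x"] by (metis prod.collapse)
      have g: "g \<in> cspan C" "s n - x - g \<in> ?A"
        using yg(1) by (auto simp: W_def intro: rev_image_eqI)
      have "s n - a - (s n - x - g) \<in> ?A"
        by (rule complex_vector.subspace_diff[OF A
              complex_vector.subspace_diff[OF A sA[rule_format] af(2)] g(2)])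
      then have "f + g \<in> ?A"
        by (simp add: af(1) algebra_simps)
      moreover have "f + g \<in> cspan C"
        using af(3) g(1) by (rule complex_vector.span_add)
      ultimately have "f + g = 0"
        by (rule C(3))
      then have "norm f = norm g"
        by (metis add_eq_0_iff norm_minus_cancel)
      also have "\<dots> \<le> norm (y, g)"
        by (rule norm_snd_le)
      finally show ?thesis using yg(2) by linarith
    qed
    moreover have "(\<lambda>n. c * norm (s n - x)) \<longlonglongrightarrow> c * norm (x - x)"
      by (intro tendsto_intros s)
    ultimately have "norm f \<le> c * norm (x - x)"
      by (meson LIMSEQ_le_const)
    then show "x \<in> ?A"
      using af by simp
  qed
qed

section \<open>Analytic perturbation\<close>

text \<open>A second-order remainder with one constant for all of \<open>U\<close>, as resolvent
  identities produce it, identifies \<open>F' w\<close> as the derivative.\<close>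

lemma analytic_family_onI:
  fixes F :: "complex \<Rightarrow> 'a::complex_normed_vector"
  assumes U: "open U"
    and bd: "\<And>z w. z \<in> U \<Longrightarrow> w \<in> U \<Longrightarrow> norm (F z - F w - (z - w) *\<^sub>C F' w) \<le> C * (cmod (z - w))\<^sup>2"
  shows "analytic_family_on F U"
  unfolding analytic_family_on_def
proof (intro ballI exI)
  fix w assume w: "w \<in> U"
  show "(F has_derivative (\<lambda>h. h *\<^sub>C F' w)) (at w)"
    unfolding has_derivative_at_alt
  proof (intro conjI allI impI bounded_linear_scaleC_left)
    fix e :: real assume e: "e > 0"
    obtain d where d: "d > 0" "ball w d \<subseteq> U"
      using U w open_contains_ball by blast
    define d' where "d' = min d (e / (\<bar>C\<bar> + 1))"
    have "norm (F z - F w - (z - w) *\<^sub>C F' w) \<le> e * norm (z - w)" if "norm (z - w) < d'" for z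
    proof -
      have "z \<in> U"
        using that d(2) by (auto simp: d'_def subset_iff dist_norm norm_minus_commute)
      then have "norm (F z - F w - (z - w) *\<^sub>C F' w) \<le> C * (cmod (z - w))\<^sup>2"
        using bd w by blast
      also have "\<dots> \<le> ((\<bar>C\<bar> + 1) * cmod (z - w)) * cmod (z - w)"
        unfolding power2_eq_square mult.assoc by (intro mult_right_mono) auto
      also have "\<dots> \<le> e * norm (z - w)"
      proof (rule mult_right_mono)
        have "norm (z - w) \<le> e / (\<bar>C\<bar> + 1)"
          using that by (simp add: d'_def)
        then show "(\<bar>C\<bar> + 1) * cmod (z - w) \<le> e"
          by (simp add: pos_le_divide_eq mult.commute)
      qed simp
      finally show ?thesis .
    qed
    moreover have "d' > 0" using d(1) e by (simp add: d'_def)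
    ultimately show "\<exists>d>0. \<forall>y. norm (y - w) < d \<longrightarrow> norm (F y - F w - (y - w) *\<^sub>C F' w) \<le> e * norm (y - w)"
      by blast
  qed
qed

lemma norm_blinfun_compose_le:
  assumes "norm f \<le> a" "norm g \<le> b"
  shows "norm (f o\<^sub>L g) \<le> a * b"
  using norm_blinfun_compose[of f g] mult_mono[OF assms] assms(1) norm_ge_zero[of f]
  by (meson norm_ge_zero order_trans)

text \<open>Neumann inversion is used twice near \<open>z\<^sub>0\<close>: to define
  \<open>H z\<close>, and to invert \<open>G z\<close> as a small perturbation of the identity.
  Resolvent identities then differentiate \<open>G\<close>.\<close>

lemma analytic_perturbation_family:
  fixes R :: "'h::{complex_normed_vector,banach} \<Rightarrow>\<^sub>L 'h"
    and Q :: "'h \<Rightarrow>\<^sub>L 'x::{complex_normed_vector,banach}" and E :: "'x \<Rightarrow>\<^sub>L 'h"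
  assumes cl: "clinear_on UNIV R" "clinear_on UNIV Q" "clinear_on UNIV E"
  obtains U G H where "open U" "z\<^sub>0 \<in> U" "analytic_family_on G U"
    "\<And>z. z \<in> U \<Longrightarrow> G z \<in> bounded_ops \<and> invertible_op (G z)"
    "\<And>z u. z \<in> U \<Longrightarrow> G z u = u + (z - z\<^sub>0) *\<^sub>C Q (H z (E u))"
    "\<And>z x. z \<in> U \<Longrightarrow> H z x - (z - z\<^sub>0) *\<^sub>C R (H z x) = x"
    "\<And>z x. z \<in> U \<Longrightarrow> H z (x - (z - z\<^sub>0) *\<^sub>C R x) = x"
proof -
  have Rc: "R (c *\<^sub>C x) = c *\<^sub>C R x" and Qc: "Q (c *\<^sub>C x) = c *\<^sub>C Q x"
    and Ec: "E (c *\<^sub>C u) = c *\<^sub>C E u" for c x u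
    using cl by (simp_all add: clinear_on_def)
  \<comment> \<open>On the disc of this radius \<open>norm (H z) \<le> 2\<close>, and with that
    bound the perturbation in \<open>G z\<close> has norm below 1; the summand 1 keeps the
    denominator positive.\<close>
  define r where "r = 1 / (2 * (norm R + norm Q * norm E + 1))"
  have pos: "0 < norm R + norm Q * norm E + 1"
    by (simp add: add_nonneg_pos)
  have r: "r > 0" using pos by (simp add: r_def)
  define U where "U = ball z\<^sub>0 r"
  have small: "cmod (z - z\<^sub>0) * norm R \<le> 1/2" "cmod (z - z\<^sub>0) * (norm Q * (2 * norm E)) < 1" if "z \<in> U" for z
  proof -
    have "cmod (z - z\<^sub>0) < r"
      using that by (simp add: U_def dist_norm norm_minus_commute)
    then have *: "cmod (z - z\<^sub>0) * norm R + cmod (z - z\<^sub>0) * (norm Q * norm E) + cmod (z - z\<^sub>0) < 1/2"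
      using pos by (simp add: r_def pos_less_divide_eq algebra_simps)
    have "0 \<le> cmod (z - z\<^sub>0) * norm R" "0 \<le> cmod (z - z\<^sub>0) * (norm Q * norm E)"
      by simp_all
    moreover have "cmod (z - z\<^sub>0) * (norm Q * (2 * norm E)) = 2 * (cmod (z - z\<^sub>0) * (norm Q * norm E))"
      by simp
    ultimately show "cmod (z - z\<^sub>0) * norm R \<le> 1/2" "cmod (z - z\<^sub>0) * (norm Q * (2 * norm E)) < 1"
      using * norm_ge_zero[of "z - z\<^sub>0"] by linarith+
  qed
  have "\<exists>B. B \<in> bounded_ops \<and> (\<forall>x. B x - (z - z\<^sub>0) *\<^sub>C R (B x) = x) \<and>
      (\<forall>x. B (x - (z - z\<^sub>0) *\<^sub>C R x) = x) \<and> norm B \<le> 2" if "z \<in> U" for z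
  proof -
    have "(z - z\<^sub>0) *\<^sub>C R \<in> bounded_ops"
      by (simp add: bounded_ops_def scaleC_blinfun.rep_eq Rc scaleC_scaleC mult.commute)
    moreover have n: "norm ((z - z\<^sub>0) *\<^sub>C R) \<le> 1/2"
      using small(1)[OF that] by (simp add: norm_scaleC)
    ultimately obtain B where "B \<in> bounded_ops" "\<And>x. B x - ((z - z\<^sub>0) *\<^sub>C R) (B x) = x"
      "\<And>x. B (x - ((z - z\<^sub>0) *\<^sub>C R) x) = x" "norm B \<le> 1 / (1 - norm ((z - z\<^sub>0) *\<^sub>C R))"
      using Neumann_inverse[of "(z - z\<^sub>0) *\<^sub>C R"] by auto
    moreover have "1 / (1 - norm ((z - z\<^sub>0) *\<^sub>C R)) \<le> 2"
      using n by (simp add: field_simps)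
    ultimately show ?thesis
      by (intro exI[of _ B]) (auto simp: scaleC_blinfun.rep_eq)
  qed
  then obtain H where H: "\<And>z. z \<in> U \<Longrightarrow> H z \<in> bounded_ops"
    and HR: "\<And>z x. z \<in> U \<Longrightarrow> H z x - (z - z\<^sub>0) *\<^sub>C R (H z x) = x"
    and HL: "\<And>z x. z \<in> U \<Longrightarrow> H z (x - (z - z\<^sub>0) *\<^sub>C R x) = x"
    and Hn: "\<And>z. z \<in> U \<Longrightarrow> norm (H z) \<le> 2"
    by metis
  have Hc: "H z (c *\<^sub>C x) = c *\<^sub>C H z x" if "z \<in> U" for z c x
    using H[OF that] by (simp add: bounded_ops_def)
  define G where "G z = id_blinfun + (z - z\<^sub>0) *\<^sub>C (Q o\<^sub>L (H z o\<^sub>L E))" for z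
  have G: "G z u = u + (z - z\<^sub>0) *\<^sub>C Q (H z (E u))" for z u
    by (simp add: G_def blinfun.add_left scaleC_blinfun.rep_eq)
  have G_bd: "G z \<in> bounded_ops" if "z \<in> U" for z
    by (simp add: bounded_ops_def G Ec Qc Hc[OF that] scaleC_add_right scaleC_scaleC mult.commute)
  have "invertible_op (G z)" if "z \<in> U" for z
  proof -
    define A where "A = - ((z - z\<^sub>0) *\<^sub>C (Q o\<^sub>L (H z o\<^sub>L E)))"
    have GA: "G z u = u - A u" for u
      by (simp add: A_def G blinfun.minus_left scaleC_blinfun.rep_eq)
    have "A \<in> bounded_ops"
      by (simp add: bounded_ops_def A_def blinfun.minus_left scaleC_blinfun.rep_eq Ec Qc Hc[OF that]
          scaleC_scaleC mult.commute scaleC_minus_right)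
    moreover have "norm A < 1"
    proof -
      have "norm A = cmod (z - z\<^sub>0) * norm (Q o\<^sub>L (H z o\<^sub>L E))"
        by (simp add: A_def norm_scaleC)
      also have "\<dots> \<le> cmod (z - z\<^sub>0) * (norm Q * (2 * norm E))"
        by (intro mult_left_mono norm_blinfun_compose_le Hn that) auto
      finally show ?thesis using small(2)[OF that] by linarith
    qed
    ultimately obtain B where B: "B \<in> bounded_ops" "\<And>x. B x - A (B x) = x" "\<And>x. B (x - A x) = x"
      by (rule Neumann_inverse) blast
    then have "B o\<^sub>L G z = id_blinfun" "G z o\<^sub>L B = id_blinfun"
      by (auto intro!: blinfun_eqI simp: GA)
    then show ?thesis
      using B(1) G_bd[OF that] by (auto simp: invertible_op_def)
  qed
  moreover have "analytic_family_on G U"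
  proof (rule analytic_family_onI)
    show "open U" by (simp add: U_def)
    fix z w assume zw: "z \<in> U" "w \<in> U"
    \<comment> \<open>\<open>?G'\<close> is the derivative of \<open>G\<close>, and
      \<open>?N\<close> is the coefficient of the squared increment in the exact remainder.\<close>
    let ?G' = "\<lambda>w. Q o\<^sub>L (H w o\<^sub>L (H w o\<^sub>L E))"
    let ?N = "Q o\<^sub>L (H z o\<^sub>L (R o\<^sub>L (H w o\<^sub>L (H w o\<^sub>L E))))"
    have first: "H z x - H w x = (z - w) *\<^sub>C H z (R (H w x))" for x
    proof -
      define y where "y = H w x"
      have x: "x = y - (w - z\<^sub>0) *\<^sub>C R y"
        using HR[OF zw(2), of x] by (simp add: y_def)
      have "H z x - y = H z (y - (w - z\<^sub>0) *\<^sub>C R y) - H z (y - (z - z\<^sub>0) *\<^sub>C R y)"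
        using HL[OF zw(1), of y] x by simp
      also have "\<dots> = H z ((z - w) *\<^sub>C R y)"
        by (simp flip: blinfun.diff_right add: scaleC_diff_left)
      finally show ?thesis
        by (simp add: y_def Hc[OF zw(1)])
    qed
    \<comment> \<open>The factor \<open>z - z\<^sub>0\<close> of \<open>G z\<close> is absorbed
      here: the difference quotient of \<open>(z - z\<^sub>0) *\<^sub>C H z x\<close> is the product
      of the two resolvents applied to \<open>x\<close>.\<close>
    have second: "(z - z\<^sub>0) *\<^sub>C H z x - (w - z\<^sub>0) *\<^sub>C H w x = (z - w) *\<^sub>C H z (H w x)" for x
    proof -
      define y where "y = H w x"
      have "H z y - (z - z\<^sub>0) *\<^sub>C H z (R y) = y"
        using HL[OF zw(1), of y] by (simp add: blinfun.diff_right Hc[OF zw(1)])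
      then have y: "H z y = y + (z - z\<^sub>0) *\<^sub>C H z (R y)"
        by (simp add: diff_eq_eq)
      have Hx: "H z x = y + (z - w) *\<^sub>C H z (R y)"
        using first[of x] by (simp add: y_def algebra_simps)
      have "(z - w) *\<^sub>C y = (z - z\<^sub>0) *\<^sub>C y - (w - z\<^sub>0) *\<^sub>C y"
        by (simp flip: scaleC_diff_left)
      then have "(z - z\<^sub>0) *\<^sub>C H z x - (w - z\<^sub>0) *\<^sub>C y
          = (z - w) *\<^sub>C y + ((z - z\<^sub>0) * (z - w)) *\<^sub>C H z (R y)"
        by (simp add: Hx scaleC_add_right scaleC_scaleC)
      also have "\<dots> = (z - w) *\<^sub>C H z y"
        by (simp add: y scaleC_add_right scaleC_scaleC mult.commute)
      finally show ?thesis by (simp add: y_def)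
    qed
    have "(G z - G w - (z - w) *\<^sub>C ?G' w) u = ((z - w) * (z - w)) *\<^sub>C ?N u" for u
    proof -
      have "G z u - G w u = Q ((z - z\<^sub>0) *\<^sub>C H z (E u) - (w - z\<^sub>0) *\<^sub>C H w (E u))"
        by (simp add: G blinfun.diff_right Qc)
      also have "\<dots> = (z - w) *\<^sub>C Q (H z (H w (E u)))"
        by (simp only: second Qc)
      finally have "(G z - G w - (z - w) *\<^sub>C ?G' w) u
          = (z - w) *\<^sub>C Q (H z (H w (E u)) - H w (H w (E u)))"
        by (simp add: blinfun.diff_left scaleC_blinfun.rep_eq blinfun.diff_right scaleC_diff_right)
      then show ?thesis
        by (simp add: first Qc scaleC_scaleC)
    qed
    then have eq: "G z - G w - (z - w) *\<^sub>C ?G' w = ((z - w) * (z - w)) *\<^sub>C ?N"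
      by (intro blinfun_eqI) (simp add: scaleC_blinfun.rep_eq)
    have "norm ?N \<le> norm Q * (2 * (norm R * (2 * (2 * norm E))))"
      by (intro norm_blinfun_compose_le Hn zw order_refl)
    then show "norm (G z - G w - (z - w) *\<^sub>C ?G' w)
        \<le> (norm Q * (2 * (norm R * (2 * (2 * norm E))))) * (cmod (z - w))\<^sup>2"
      unfolding eq norm_scaleC norm_mult power2_eq_square
      by (metis mult.commute mult_left_mono norm_ge_zero norm_mult)
  qed
  moreover have "open U" "z\<^sub>0 \<in> U"
    using r by (simp_all add: U_def)
  ultimately show thesis
    using that[of U G H] G G_bd HR HL by blast
qed

section \<open>Boundary maps\<close>

lemma clinear_onD:
  assumes "clinear_on D f"
  shows "x \<in> D \<Longrightarrow> y \<in> D \<Longrightarrow> f (x + y) = f x + f y"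
    and "x \<in> D \<Longrightarrow> f (c *\<^sub>C x) = c *\<^sub>C f x"
  using assms by (simp_all add: clinear_on_def)

lemma clinear_on_diff:
  assumes "csubspace D" "clinear_on D f" "x \<in> D" "y \<in> D"
  shows "f (x - y) = f x - f y"
proof -
  have "x - y \<in> D"
    using assms complex_vector.subspace_diff by blast
  then have "f ((x - y) + y) = f (x - y) + f y"
    using assms(4) by (rule clinear_onD[OF assms(2)])
  then show ?thesis by (simp add: algebra_simps)
qed

text \<open>The standard skew-Hermitian form on the space of boundary values, that is, the
  right-hand side of Green's identity.\<close>

definition boundary_form :: "'k::complex_inner \<times> 'k \<Rightarrow> 'k \<times> 'k \<Rightarrow> complex"
  where "boundary_form u v = cinner (fst u) (snd v) - cinner (snd u) (fst v)"

lemma boundary_form_nondegenerate: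
  assumes "\<And>v. boundary_form u v = 0"
  shows "u = 0"
proof -
  have "cinner (fst u) (fst u) = 0" "cinner (snd u) (snd u) = 0"
    using assms[of "(0, fst u)"] assms[of "(snd u, 0)"] by (simp_all add: boundary_form_def)
  then show ?thesis by (simp add: prod_eq_iff)
qed

lemma boundary_form_diff_left: "boundary_form (u - u') v = boundary_form u v - boundary_form u' v"
  by (simp add: boundary_form_def cinner_diff_left)

text \<open>The properties of the adjoint \<open>T\<close> and of the triplet, stated without
  reference to \<open>S\<close>. The assumption \<open>ran_orthogonal\<close> retains what symmetry
  of \<open>S\<close> gives: a vector orthogonal to the range of \<open>T - z\<close> is orthogonal
  to that of \<open>S - z\<close>, hence lies in the kernel of \<open>T - cnj z\<close>.\<close>

locale boundary_map =
  fixes D :: "'h::chilbert_space set" and T :: "'h \<Rightarrow> 'h"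
    and \<Gamma> :: "'h \<Rightarrow> 'k::chilbert_space \<times> 'k" and z\<^sub>0 :: complex
  assumes D: "csubspace D" and T: "clinear_on D T" and \<Gamma>: "clinear_on D \<Gamma>"
    and closed_T: "closed {v. fst v \<in> D \<and> snd v = T (fst v)}"
    and surj: "\<Gamma> ` D = UNIV"
    and green: "\<And>f g. f \<in> D \<Longrightarrow> g \<in> D \<Longrightarrow>
      cinner f (T g) - cinner (T f) g = boundary_form (\<Gamma> f) (\<Gamma> g)"
    and ran_orthogonal: "\<And>z n. (\<And>g. g \<in> D \<Longrightarrow> cinner n (T g - z *\<^sub>C g) = 0) \<Longrightarrow>
      n \<in> D \<and> T n = cnj z *\<^sub>C n"
    and finite_codim: "\<exists>B. finite B \<and> cspan ((\<lambda>f. T f - z\<^sub>0 *\<^sub>C f) ` D \<union> B) = UNIV"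
begin

lemmas D_simps = complex_vector.subspace_add[OF D] complex_vector.subspace_diff[OF D]
  complex_vector.subspace_scale[OF D] complex_vector.subspace_0[OF D]
lemmas T_simps = clinear_onD[OF T] clinear_on_diff[OF D T]
lemmas \<Gamma>_simps = clinear_onD[OF \<Gamma>] clinear_on_diff[OF D \<Gamma>]

lemma T_0 [simp]: "T 0 = 0" and \<Gamma>_0 [simp]: "\<Gamma> 0 = 0"
  using T_simps(2)[of 0 0] \<Gamma>_simps(2)[of 0 0] D_simps(4) by simp_all

section \<open>Graphs, kernels and the range of the shifted operator\<close>

definition grT :: "('h \<times> 'h) set"
  where "grT = {v. fst v \<in> D \<and> snd v = T (fst v)}"

lemma csubspace_grT: "csubspace grT"
  by (auto simp: complex_vector.subspace_def grT_def scaleC_prod_def D_simps T_simps)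

lemma closed_grT: "closed grT"
  using closed_T by (simp add: grT_def)

text \<open>Recording \<open>T f\<close> next to \<open>\<Gamma> f\<close> makes closedness of this
  set express that \<Gamma> is closed with respect to the graph norm of \<open>T\<close>.\<close>

definition gr\<Gamma> :: "('h \<times> 'h \<times> 'k \<times> 'k) set"
  where "gr\<Gamma> = {v. fst v \<in> D \<and> fst (snd v) = T (fst v) \<and> snd (snd v) = \<Gamma> (fst v)}"

lemma csubspace_gr\<Gamma>: "csubspace gr\<Gamma>"
  by (auto simp: complex_vector.subspace_def gr\<Gamma>_def scaleC_prod_def[where 'a='h] D_simps T_simps \<Gamma>_simps)

text \<open>By nondegeneracy, Green's identity determines \<open>\<Gamma> f\<close> by a condition that is
  continuous in \<open>f\<close>, \<open>T f\<close> and \<open>\<Gamma> f\<close>.\<close>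

lemma closed_gr\<Gamma>: "closed gr\<Gamma>"
proof -
  have eq: "gr\<Gamma> = {v. (fst v, fst (snd v)) \<in> grT \<and>
      (\<forall>g\<in>D. cinner (fst v) (T g) - cinner (fst (snd v)) g = boundary_form (snd (snd v)) (\<Gamma> g))}"
    (is "_ = ?R")
  proof (intro set_eqI iffI)
    fix v assume "v \<in> gr\<Gamma>"
    then show "v \<in> ?R"
      by (simp add: gr\<Gamma>_def grT_def green)
  next
    fix v assume v: "v \<in> ?R"
    have "boundary_form (snd (snd v) - \<Gamma> (fst v)) w = 0" for w
    proof -
      obtain g where g: "g \<in> D" "w = \<Gamma> g"
        using surj by blast
      moreover have "boundary_form (snd (snd v)) (\<Gamma> g) = cinner (fst v) (T g) - cinner (fst (snd v)) g"
        using v g(1) by auto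
      ultimately show ?thesis
        using v green[of "fst v" g] by (simp add: boundary_form_diff_left grT_def)
    qed
    then have "snd (snd v) - \<Gamma> (fst v) = 0"
      by (rule boundary_form_nondegenerate)
    then show "v \<in> gr\<Gamma>"
      using v by (simp add: gr\<Gamma>_def grT_def)
  qed
  show ?thesis
    unfolding eq boundary_form_def
    by (intro closed_Collect_conj closed_Collect_ball closed_Collect_eq
        closed_Collect_mem[OF closed_grT] continuous_intros)
qed

definition A :: "'h set"
  where "A = (\<lambda>f. T f - z\<^sub>0 *\<^sub>C f) ` D"

definition N :: "complex \<Rightarrow> 'h set"
  where "N z = {f \<in> D. T f = z *\<^sub>C f}"

lemma csubspace_N: "csubspace (N z)"
  by (auto simp: complex_vector.subspace_def N_def D_simps T_simps scaleC_add_right scaleC_scaleC mult.commute)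

lemma closed_N: "closed (N z)"
proof -
  have "N z = {f. (f, z *\<^sub>C f) \<in> grT}"
    by (auto simp: N_def grT_def)
  then show ?thesis
    by (simp only:) (intro closed_Collect_mem[OF closed_grT] continuous_intros)
qed

text \<open>\<open>A\<close> is the first projection of the closed relation of triples
  \<open>(T f - z\<^sub>0 *\<^sub>C f, f, T f)\<close>, to which the closed range lemma
  applies.\<close>

lemma csubspace_A: "csubspace A" and closed_A: "closed A"
proof -
  define V where "V = {v. (fst (snd v), snd (snd v)) \<in> grT \<and> fst v = snd (snd v) - z\<^sub>0 *\<^sub>C fst (snd v)}"
  have "csubspace V"
    using complex_vector.subspace_add[OF csubspace_grT] complex_vector.subspace_scale[OF csubspace_grT]
      complex_vector.subspace_0[OF csubspace_grT]
    by (auto simp: complex_vector.subspace_def V_def scaleC_prod_def zero_prod_def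
        scaleC_add_right scaleC_diff_right scaleC_scaleC mult.commute)
  moreover have "closed V"
    unfolding V_def
    by (intro closed_Collect_conj closed_Collect_eq closed_Collect_mem[OF closed_grT] continuous_intros)
  moreover have VA: "fst ` V = A"
  proof (intro set_eqI iffI)
    fix x assume "x \<in> A"
    then obtain f where f: "f \<in> D" "x = T f - z\<^sub>0 *\<^sub>C f"
      by (auto simp: A_def)
    then have "(x, f, T f) \<in> V"
      by (simp add: V_def grT_def)
    then show "x \<in> fst ` V"
      by (rule rev_image_eqI) simp
  qed (auto simp: V_def A_def grT_def)
  moreover obtain B where "finite B" "cspan (A \<union> B) = UNIV"
    using finite_codim by (auto simp: A_def)
  ultimately show "csubspace A" "closed A"
    using csubspace_fst_image[of V] closed_range_finite_codimension[of V B] by simp_all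
qed

text \<open>This is what removes a possible real eigenvalue \<open>z\<^sub>0\<close> of the minimal operator: the
  orthogonal complement of the range is invisible to \<open>\<Gamma>\<close>.\<close>

lemma orthogonal_A:
  assumes n: "\<And>a. a \<in> A \<Longrightarrow> cinner n a = 0"
  shows "n \<in> N z\<^sub>0" "\<Gamma> n = 0"
proof -
  have n0: "cinner n (T g - z\<^sub>0 *\<^sub>C g) = 0" if "g \<in> D" for g
    using n that by (auto simp: A_def)
  have nD: "n \<in> D" "T n = cnj z\<^sub>0 *\<^sub>C n"
    using ran_orthogonal[of n z\<^sub>0] n0 by auto
  have pair: "cinner n (T g) = cinner (T n) g" if "g \<in> D" for g
    using n0[OF that] by (simp add: nD(2) cinner_scaleC_left cinner_diff_right cinner_scaleC_right)
  have "boundary_form (\<Gamma> n) w = 0" for w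
  proof -
    obtain g where "g \<in> D" "w = \<Gamma> g"
      using surj by blast
    then show ?thesis
      using green[OF nD(1), of g] pair by simp
  qed
  then show "\<Gamma> n = 0"
    by (rule boundary_form_nondegenerate)
  \<comment> \<open>Either \<open>n = 0\<close> or \<open>z\<^sub>0\<close> is real, so
    \<open>cnj z\<^sub>0\<close> may be replaced by \<open>z\<^sub>0\<close> in the equation for
    \<open>T n\<close>.\<close>
  have "cnj z\<^sub>0 * cinner n n = z\<^sub>0 * cinner n n"
    using pair[OF nD(1)] by (simp add: nD(2) cinner_scaleC_left cinner_scaleC_right)
  then show "n \<in> N z\<^sub>0"
    using nD by (auto simp: N_def)
qed

text \<open>Green's identity makes \<open>cinner s (T s)\<close> real once
  \<open>\<Gamma> s = 0\<close>, and the two squared norms then expand equally. This converts the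
  \<open>cnj z\<^sub>0\<close> that duality produces back into \<open>z\<^sub>0\<close>.\<close>

lemma norm_shift_cnj:
  assumes s: "s \<in> D" "\<Gamma> s = 0"
  shows "norm (T s - cnj z *\<^sub>C s) = norm (T s - z *\<^sub>C s)"
proof -
  have "cinner s (T s) = cinner (T s) s"
    using green[OF s(1) s(1)] s(2) by (simp add: boundary_form_def)
  then have "cinner (T s - cnj z *\<^sub>C s) (T s - cnj z *\<^sub>C s) = cinner (T s - z *\<^sub>C s) (T s - z *\<^sub>C s)"
    by (simp add: cinner_diff_left cinner_diff_right cinner_scaleC_left cinner_scaleC_right algebra_simps)
  then show ?thesis
    by (simp add: norm_eq_sqrt_inner flip: Re_cinner)
qed

text \<open>Choosing \<open>R h\<close> orthogonal to the kernel, which contains the orthogonal complement of \<open>A\<close>,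
  forces \<open>R h\<close> into \<open>A\<close>.\<close>

lemma right_inverse:
  obtains P R where "clinear_on UNIV (blinfun_apply P)" "\<And>x. P x \<in> A"
    "\<And>x m. m \<in> A \<Longrightarrow> cinner m (x - P x) = 0" "\<And>x. x \<in> A \<Longrightarrow> P x = x"
    "clinear_on UNIV (blinfun_apply R)" "\<And>h. R h \<in> D" "\<And>h. T (R h) - z\<^sub>0 *\<^sub>C R h = P h" "\<And>h. R h \<in> A"
proof -
  obtain P where P: "clinear_on UNIV (blinfun_apply P)" "\<And>x. P x \<in> A"
    "\<And>x m. m \<in> A \<Longrightarrow> cinner m (x - P x) = 0" "\<And>x. x \<in> A \<Longrightarrow> P x = x"
    using orthogonal_projection[OF csubspace_A closed_A] by blast
  have P_lin: "P (c *\<^sub>C x) = c *\<^sub>C P x" for c x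
    using clinear_onD(2)[OF P(1)] by simp
  \<comment> \<open>Composing with \<open>P\<close> extends the right inverse by zero from
    \<open>A\<close> to the whole space.\<close>
  define V where "V = {v. (snd v, P (fst v) + z\<^sub>0 *\<^sub>C snd v) \<in> grT \<and> (\<forall>k\<in>N z\<^sub>0. cinner k (snd v) = 0)}"
  have V: "(x, y) \<in> V \<longleftrightarrow> y \<in> D \<and> T y = P x + z\<^sub>0 *\<^sub>C y \<and> (\<forall>k\<in>N z\<^sub>0. cinner k y = 0)" for x y
    by (auto simp: V_def grT_def)
  have "csubspace V"
    by (auto simp: complex_vector.subspace_def zero_prod_def V D_simps T_simps blinfun.zero_right
        cinner_add_right cinner_scaleC_right blinfun.add_right P_lin scaleC_add_right scaleC_scaleC mult.commute)
  moreover have "closed V"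
    unfolding V_def
    by (intro closed_Collect_conj closed_Collect_ball closed_Collect_eq
        closed_Collect_mem[OF closed_grT] continuous_intros)
  moreover have "\<exists>!y. (x, y) \<in> V" for x
  proof (rule ex_ex1I)
    obtain g where g: "g \<in> D" "P x = T g - z\<^sub>0 *\<^sub>C g"
      using P(2)[of x] by (auto simp: A_def)
    obtain p where p: "p \<in> N z\<^sub>0" "\<And>k. k \<in> N z\<^sub>0 \<Longrightarrow> cinner k (g - p) = 0"
      using orthogonal_decomposition[OF csubspace_N closed_N] by blast
    have "p \<in> D" "T p = z\<^sub>0 *\<^sub>C p"
      using p(1) by (simp_all add: N_def)
    then have "(x, g - p) \<in> V"
      using g p(2) by (simp add: V D_simps T_simps scaleC_diff_right)
    then show "\<exists>y. (x, y) \<in> V" ..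
  next
    fix f g assume f: "(x, f) \<in> V" and g: "(x, g) \<in> V"
    then have "f - g \<in> N z\<^sub>0"
      by (simp add: V N_def D_simps T_simps(3)[of f g] scaleC_diff_right)
    then have "cinner (f - g) (f - g) = 0"
      using f g unfolding cinner_diff_right by (simp add: V)
    then show "f = g" by simp
  qed
  ultimately obtain R where R: "clinear_on UNIV (blinfun_apply R)" "\<And>x y. (x, y) \<in> V \<longleftrightarrow> y = R x"
    by (rule cclosed_graph) blast
  have RV: "(h, R h) \<in> V" for h
    using R(2) by simp
  have RD: "R h \<in> D" and RT: "T (R h) = P h + z\<^sub>0 *\<^sub>C R h"
    and R_orth: "k \<in> N z\<^sub>0 \<Longrightarrow> cinner k (R h) = 0" for h k
    using RV[of h] by (auto simp: V)
  have RA: "R h \<in> A" for h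
  proof -
    define n where "n = R h - P (R h)"
    have n: "cinner a n = 0" if "a \<in> A" for a
      using P(3)[OF that] by (simp add: n_def)
    then have "n \<in> N z\<^sub>0"
      by (intro orthogonal_A(1)) (simp add: cinner_eq_0_sym)
    then have "cinner n (R h) = 0"
      by (rule R_orth)
    moreover have "cinner n (P (R h)) = 0"
      using n[OF P(2)] by (simp add: cinner_eq_0_sym)
    ultimately have "cinner n n = 0"
      by (subst (2) n_def) (simp add: cinner_diff_right)
    then have "R h = P (R h)"
      by (simp add: n_def)
    then show ?thesis
      using P(2)[of "R h"] by simp
  qed
  show thesis
    using that[OF P R(1) RD _ RA] RT by simp
qed

text \<open>Open mapping supplies \<open>g\<close> with the boundary values of \<open>f\<close> and
  graph norm controlled by \<open>norm (\<Gamma> f)\<close>. The difference \<open>s = f - g\<close>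
  lies in the kernel of \<Gamma>, where duality bounds its component in \<open>A\<close> by
  \<open>T s - z\<^sub>0 *\<^sub>C s\<close>, an expression in \<open>g\<close> alone.\<close>

lemma boundary_lower_bound:
  obtains C where "\<And>f. f \<in> N z\<^sub>0 \<inter> A \<Longrightarrow> norm f \<le> C * norm (\<Gamma> f)"
proof -
  obtain P R :: "'h \<Rightarrow>\<^sub>L 'h" where P: "\<And>x. P x \<in> A" "\<And>x m. m \<in> A \<Longrightarrow> cinner m (x - P x) = 0" "\<And>x. x \<in> A \<Longrightarrow> P x = x"
    and R: "\<And>h. R h \<in> D" "\<And>h. T (R h) - z\<^sub>0 *\<^sub>C R h = P h"
    by (rule right_inverse) blast
  \<comment> \<open>On \<open>A\<close>, \<open>s\<close> is the image of \<open>R s\<close> under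
    \<open>T - z\<^sub>0\<close>; Green's identity moves the operator onto the other factor
    \<open>s\<close> without boundary terms.\<close>
  have minimal: "norm s \<le> norm R * norm (T s - z\<^sub>0 *\<^sub>C s)" if s: "s \<in> D" "\<Gamma> s = 0" "s \<in> A" for s
  proof (cases "s = 0")
    case False
    have pair: "cinner s (T (R s)) = cinner (T s) (R s)"
      using green[OF s(1) R(1), of s] s(2) by (simp add: boundary_form_def)
    have "cinner s s = cinner s (T (R s) - z\<^sub>0 *\<^sub>C R s)"
      using P(3)[OF s(3)] R(2) by simp
    also have "\<dots> = cinner (T s - cnj z\<^sub>0 *\<^sub>C s) (R s)"
      by (simp add: cinner_diff_right cinner_diff_left cinner_scaleC_right cinner_scaleC_left pair)
    finally have "inner s s = inner (T s - cnj z\<^sub>0 *\<^sub>C s) (R s)"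
      by (simp flip: Re_cinner)
    also have "\<dots> \<le> norm (T s - cnj z\<^sub>0 *\<^sub>C s) * norm (R s)"
      by (rule norm_cauchy_schwarz)
    also have "\<dots> \<le> norm (T s - z\<^sub>0 *\<^sub>C s) * (norm R * norm s)"
      unfolding norm_shift_cnj[OF s(1,2)] by (intro mult_left_mono norm_blinfun) simp
    finally have "norm s * norm s \<le> (norm R * norm (T s - z\<^sub>0 *\<^sub>C s)) * norm s"
      by (simp add: power2_norm_eq_inner[symmetric] power2_eq_square mult_ac)
    then show ?thesis
      using False by simp
  qed simp
  define V where "V = {v. (fst (snd v), snd (snd v), fst v) \<in> gr\<Gamma>}"
  have "subspace V"
    using complex_vector.subspace_add[OF csubspace_gr\<Gamma>] complex_vector.subspace_scale[OF csubspace_gr\<Gamma>]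
      complex_vector.subspace_0[OF csubspace_gr\<Gamma>]
    by (intro csubspace_imp_subspace)
       (auto simp: complex_vector.subspace_def V_def scaleC_prod_def[where 'b="'h \<times> 'h"]
         scaleC_prod_def[where 'a='h] zero_prod_def[where 'a='h])
  moreover have "closed V"
    unfolding V_def by (intro closed_Collect_mem[OF closed_gr\<Gamma>] continuous_intros)
  moreover have "fst ` V = UNIV"
  proof -
    have "u \<in> fst ` V" for u
    proof -
      obtain g where g: "g \<in> D" "u = \<Gamma> g"
        using surj by blast
      then have "(u, g, T g) \<in> V"
        by (simp add: V_def gr\<Gamma>_def)
      then show ?thesis by (rule rev_image_eqI) simp
    qed
    then show ?thesis by blast
  qed
  ultimately obtain c where c: "c \<ge> 0" "\<And>u. \<exists>y. (u, y) \<in> V \<and> norm y \<le> c * norm u"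
    by (rule open_mapping_closed_relation) blast
  define K where "K = norm P + norm R * (1 + cmod z\<^sub>0)"
  have "norm f \<le> (K * c) * norm (\<Gamma> f)" if f: "f \<in> N z\<^sub>0 \<inter> A" for f
  proof -
    have fD: "f \<in> D" "T f = z\<^sub>0 *\<^sub>C f" "f \<in> A"
      using f by (simp_all add: N_def)
    obtain g where g: "g \<in> D" "\<Gamma> g = \<Gamma> f" "norm (g, T g) \<le> c * norm (\<Gamma> f)"
      using c(2)[of "\<Gamma> f"] by (auto simp: V_def gr\<Gamma>_def)
    \<comment> \<open>\<open>s\<close> need not lie in \<open>A\<close>, but its component
      \<open>n\<close> orthogonal to \<open>A\<close> lies in both kernels, so passing to
      \<open>P s\<close> changes neither \<open>\<Gamma> s\<close> nor
      \<open>T s - z\<^sub>0 *\<^sub>C s\<close>.\<close>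
    define s n where "s = f - g" and "n = s - P s"
    have s: "s \<in> D" "\<Gamma> s = 0" "T s - z\<^sub>0 *\<^sub>C s = - (T g - z\<^sub>0 *\<^sub>C g)"
      using fD g by (simp_all add: s_def D_simps \<Gamma>_simps T_simps scaleC_diff_right)
    have n: "n \<in> N z\<^sub>0" "\<Gamma> n = 0"
      using orthogonal_A[of n] P(2) by (simp_all add: n_def cinner_eq_0_sym)
    have nD: "n \<in> D" "T n = z\<^sub>0 *\<^sub>C n"
      using n(1) by (simp_all add: N_def)
    have Ps: "P s = s - n"
      by (simp add: n_def)
    have "norm (P s) \<le> norm R * norm (T (P s) - z\<^sub>0 *\<^sub>C P s)"
    proof (rule minimal[OF _ _ P(1)])
      show "P s \<in> D" "\<Gamma> (P s) = 0"
        unfolding Ps using s n(2) nD(1) by (simp_all add: D_simps \<Gamma>_simps)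
    qed
    also have "T (P s) - z\<^sub>0 *\<^sub>C P s = - (T g - z\<^sub>0 *\<^sub>C g)"
      unfolding Ps using s nD by (simp add: T_simps scaleC_diff_right)
    also have "norm R * norm \<dots> \<le> norm R * (norm (T g) + cmod z\<^sub>0 * norm g)"
      using norm_triangle_ineq4[of "T g" "z\<^sub>0 *\<^sub>C g"]
      by (intro mult_left_mono) (auto simp: norm_scaleC norm_minus_commute)
    also have "\<dots> \<le> norm R * (norm (g, T g) + cmod z\<^sub>0 * norm (g, T g))"
      using norm_fst_le[of g "T g"] norm_snd_le[of "T g" g]
      by (intro mult_left_mono add_mono) auto
    finally have 1: "norm (P s) \<le> norm R * (1 + cmod z\<^sub>0) * norm (g, T g)"
      by (simp add: algebra_simps)
    have "norm (P g) \<le> norm P * norm g"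
      by (rule norm_blinfun)
    also have "\<dots> \<le> norm P * norm (g, T g)"
      by (intro mult_left_mono norm_fst_le) simp
    finally have 2: "norm (P g) \<le> norm P * norm (g, T g)" .
    have "f = P g + P s"
      using P(3)[OF fD(3)] by (simp add: s_def blinfun.diff_right)
    then have "norm f \<le> norm (P g) + norm (P s)"
      using norm_triangle_ineq by metis
    also have "\<dots> \<le> K * norm (g, T g)"
      using 1 2 by (simp add: K_def distrib_right)
    also have "\<dots> \<le> K * (c * norm (\<Gamma> f))"
      by (intro mult_left_mono g(3)) (simp add: K_def)
    finally show ?thesis by (simp add: mult.assoc)
  qed
  then show thesis
    by (rule that)
qed

section \<open>Inverting the boundary map on the part of the kernel inside \<open>A\<close>\<close>

lemma N_Int_A: "csubspace (N z \<inter> A)" "closed (N z \<inter> A)"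
  using complex_vector.subspace_inter[OF csubspace_N csubspace_A] closed_N closed_A by auto

text \<open>The lower bound carries the Cauchy property from boundary values back to kernel vectors,
  and closedness of \<open>gr\<Gamma>\<close> identifies the boundary value of the limit.\<close>

lemma closed_boundary_image: "closed (\<Gamma> ` (N z\<^sub>0 \<inter> A))"
  unfolding closed_sequential_limits
proof (intro allI impI, elim conjE)
  let ?L = "N z\<^sub>0 \<inter> A"
  fix s u assume "\<forall>n. s n \<in> \<Gamma> ` ?L" and s: "s \<longlonglongrightarrow> u"
  then have "\<forall>n. \<exists>f. f \<in> ?L \<and> s n = \<Gamma> f"
    by blast
  from choice[OF this] obtain f where f: "\<And>n. f n \<in> ?L" "\<And>n. s n = \<Gamma> (f n)"
    by blast
  obtain C where C: "\<And>f. f \<in> ?L \<Longrightarrow> norm f \<le> C * norm (\<Gamma> f)"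
    using boundary_lower_bound by blast
  have fD: "f n \<in> D" "T (f n) = z\<^sub>0 *\<^sub>C f n" for n
    using f(1)[of n] by (simp_all add: N_def)
  have bound: "norm (f m - f n) \<le> (\<bar>C\<bar> + 1) * norm (s m - s n)" for m n
  proof -
    have "norm (f m - f n) \<le> C * norm (\<Gamma> (f m - f n))"
      by (intro C complex_vector.subspace_diff[OF N_Int_A(1)] f(1))
    also have "\<Gamma> (f m - f n) = s m - s n"
      by (simp add: \<Gamma>_simps(3) fD f(2))
    also have "C * norm \<dots> \<le> (\<bar>C\<bar> + 1) * norm (s m - s n)"
      by (intro mult_right_mono) auto
    finally show ?thesis .
  qed
  have "Cauchy f"
  proof (rule metric_CauchyI)
    fix e :: real assume "e > 0"
    then have "e / (\<bar>C\<bar> + 1) > 0" by simp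
    then obtain M where M: "\<And>m n. m \<ge> M \<Longrightarrow> n \<ge> M \<Longrightarrow> dist (s m) (s n) < e / (\<bar>C\<bar> + 1)"
      using LIMSEQ_imp_Cauchy[OF s] metric_CauchyD by blast
    have "dist (f m) (f n) < e" if "m \<ge> M" "n \<ge> M" for m n
    proof -
      have "(\<bar>C\<bar> + 1) * norm (s m - s n) < e"
        using M[OF that] by (simp add: dist_norm pos_less_divide_eq mult.commute)
      then show ?thesis
        using bound[of m n] by (simp add: dist_norm)
    qed
    then show "\<exists>M. \<forall>m\<ge>M. \<forall>n\<ge>M. dist (f m) (f n) < e" by blast
  qed
  then obtain g where g: "f \<longlonglongrightarrow> g"
    using Cauchy_convergent convergent_def by blast
  have "(\<lambda>n. (f n, z\<^sub>0 *\<^sub>C f n, s n)) \<longlonglongrightarrow> (g, z\<^sub>0 *\<^sub>C g, u)"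
    by (intro tendsto_Pair tendsto_scaleC g s)
  then have "(g, z\<^sub>0 *\<^sub>C g, u) \<in> gr\<Gamma>"
    by (rule closed_sequentially[OF closed_gr\<Gamma>, rotated]) (simp add: gr\<Gamma>_def fD f(2))
  moreover have "g \<in> ?L"
    by (rule closed_sequentially[OF N_Int_A(2) f(1) g])
  ultimately show "u \<in> \<Gamma> ` ?L"
    by (auto simp: gr\<Gamma>_def)
qed

text \<open>\<open>E\<close> is the orthogonal projection onto the closed boundary image followed by
  the inverse of \<Gamma> there; injectivity comes from the lower bound.\<close>

lemma boundary_inverse:
  obtains E where "clinear_on UNIV (blinfun_apply E)" "\<And>f. f \<in> N z\<^sub>0 \<inter> A \<Longrightarrow> E (\<Gamma> f) = f"
proof -
  let ?L = "N z\<^sub>0 \<inter> A"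
  have LD: "f \<in> D" "T f = z\<^sub>0 *\<^sub>C f" if "f \<in> ?L" for f
    using that by (simp_all add: N_def)
  have "csubspace (\<Gamma> ` ?L)"
  proof -
    have "\<Gamma> f + \<Gamma> g \<in> \<Gamma> ` ?L" if "f \<in> ?L" "g \<in> ?L" for f g
      using that complex_vector.subspace_add[OF N_Int_A(1) that] LD
      by (intro rev_image_eqI[of "f + g"]) (simp_all add: \<Gamma>_simps)
    moreover have "c *\<^sub>C \<Gamma> f \<in> \<Gamma> ` ?L" if "f \<in> ?L" for c f
      using complex_vector.subspace_scale[OF N_Int_A(1) that] LD[OF that]
      by (intro rev_image_eqI[of "c *\<^sub>C f"]) (simp_all add: \<Gamma>_simps)
    moreover have "0 \<in> \<Gamma> ` ?L"
      using complex_vector.subspace_0[OF N_Int_A(1)] by (intro rev_image_eqI[of 0]) simp_all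
    ultimately show ?thesis
      unfolding complex_vector.subspace_def by auto
  qed
  then obtain P where P: "clinear_on UNIV (blinfun_apply P)" "\<And>u. P u \<in> \<Gamma> ` ?L"
    "\<And>u. u \<in> \<Gamma> ` ?L \<Longrightarrow> P u = u"
    using orthogonal_projection[OF _ closed_boundary_image] by metis
  have P_lin: "P (c *\<^sub>C x) = c *\<^sub>C P x" for c x
    using clinear_onD(2)[OF P(1)] by simp
  obtain C where C: "\<And>f. f \<in> ?L \<Longrightarrow> norm f \<le> C * norm (\<Gamma> f)"
    using boundary_lower_bound by blast
  have inj: "f = g" if "f \<in> ?L" "g \<in> ?L" "\<Gamma> f = \<Gamma> g" for f g
  proof -
    have "norm (f - g) \<le> C * norm (\<Gamma> (f - g))"
      by (intro C complex_vector.subspace_diff[OF N_Int_A(1)] that)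
    also have "\<Gamma> (f - g) = 0"
      using that LD(1) by (simp add: \<Gamma>_simps(3))
    finally show ?thesis by simp
  qed
  \<comment> \<open>On \<open>?L\<close> the middle entry equals \<open>T (snd v)\<close>; in this
    form membership is a continuous preimage of \<open>gr\<Gamma>\<close>, hence a closed
    condition.\<close>
  define V where "V = {v. snd v \<in> ?L \<and> (snd v, z\<^sub>0 *\<^sub>C snd v, P (fst v)) \<in> gr\<Gamma>}"
  have V: "(u, f) \<in> V \<longleftrightarrow> f \<in> ?L \<and> \<Gamma> f = P u" for u f
    using LD by (auto simp: V_def gr\<Gamma>_def)
  have "csubspace V"
    unfolding complex_vector.subspace_def
  proof (intro conjI ballI allI)
    show "0 \<in> V"
      using complex_vector.subspace_0[OF N_Int_A(1)]
      by (simp add: zero_prod_def[where 'a="'k \<times> 'k" and 'b='h] V blinfun.zero_right)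
  next
    fix v w assume vw: "v \<in> V" "w \<in> V"
    obtain u f u' f' where [simp]: "v = (u, f)" "w = (u', f')" by (cases v, cases w)
    have fs: "f \<in> ?L" "\<Gamma> f = P u" "f' \<in> ?L" "\<Gamma> f' = P u'"
      using vw by (simp_all add: V)
    then have "\<Gamma> (f + f') = P (u + u')"
      using LD by (simp add: \<Gamma>_simps blinfun.add_right)
    then show "v + w \<in> V"
      using complex_vector.subspace_add[OF N_Int_A(1) fs(1,3)] by (simp add: V)
  next
    fix c v assume v: "v \<in> V"
    obtain u f where [simp]: "v = (u, f)" by (cases v)
    have fs: "f \<in> ?L" "\<Gamma> f = P u"
      using v by (simp_all add: V)
    then have "\<Gamma> (c *\<^sub>C f) = P (c *\<^sub>C u)"
      using LD(1) by (simp add: \<Gamma>_simps P_lin)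
    then show "c *\<^sub>C v \<in> V"
      using complex_vector.subspace_scale[OF N_Int_A(1) fs(1)] by (simp add: V scaleC_Pair[of c u f])
  qed
  moreover have "closed V"
    unfolding V_def
    by (intro closed_Collect_conj closed_Collect_mem[OF N_Int_A(2)]
        closed_Collect_mem[OF closed_gr\<Gamma>] continuous_intros)
  moreover have "\<exists>!f. (u, f) \<in> V" for u
  proof (rule ex_ex1I)
    show "\<exists>f. (u, f) \<in> V"
      using P(2)[of u] by (auto simp: V)
    show "f = g" if "(u, f) \<in> V" "(u, g) \<in> V" for f g
      using that by (intro inj) (simp_all add: V)
  qed
  ultimately obtain E where E: "clinear_on UNIV (blinfun_apply E)" "\<And>u f. (u, f) \<in> V \<longleftrightarrow> f = E u"
    using cclosed_graph[of V] by blast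
  have "E (\<Gamma> f) = f" if "f \<in> ?L" for f
  proof -
    have "P (\<Gamma> f) = \<Gamma> f"
      using that by (intro P(3)) blast
    then show ?thesis
      using E(2)[of "\<Gamma> f" f] that by (simp add: V)
  qed
  then show thesis
    using that[OF E(1)] by simp
qed

text \<open>For \<open>f\<close> in \<open>?L\<close>, the fixed point equation of
  \<open>H z f\<close> gives \<open>G z (\<Gamma> f) = \<Gamma> (H z f)\<close>. Away from
  \<open>z\<^sub>0\<close>, transport of the boundary spaces thus reduces to \<open>H z\<close>
  carrying \<open>?L\<close> onto \<open>N z\<close>.\<close>

lemma analytic_boundary_family:
  obtains U G where "open U" "z\<^sub>0 \<in> U" "analytic_family_on G U"
    "\<And>z. z \<in> U \<Longrightarrow> G z \<in> bounded_ops \<and> invertible_op (G z)"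
    "G z\<^sub>0 = id_blinfun" "\<And>z. z \<in> U \<Longrightarrow> blinfun_apply (G z) ` \<Gamma> ` N z\<^sub>0 = \<Gamma> ` N z"
proof -
  let ?L = "N z\<^sub>0 \<inter> A"
  obtain P R :: "'h \<Rightarrow>\<^sub>L 'h" where P: "clinear_on UNIV (blinfun_apply P)" "\<And>x. P x \<in> A"
      "\<And>x m. m \<in> A \<Longrightarrow> cinner m (x - P x) = 0" "\<And>x. x \<in> A \<Longrightarrow> P x = x"
    and R: "clinear_on UNIV (blinfun_apply R)" "\<And>h. R h \<in> D" "\<And>h. T (R h) - z\<^sub>0 *\<^sub>C R h = P h"
      "\<And>h. R h \<in> A"
    by (rule right_inverse) blast
  have TR: "T (R h) = P h + z\<^sub>0 *\<^sub>C R h" for h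
    using R(3)[of h] by (simp add: diff_eq_eq)
  obtain E :: "('k \<times> 'k) \<Rightarrow>\<^sub>L 'h" where E: "clinear_on UNIV (blinfun_apply E)" "\<And>f. f \<in> ?L \<Longrightarrow> E (\<Gamma> f) = f"
    by (rule boundary_inverse) blast
  \<comment> \<open>This is the graph of \<Gamma> composed with \<open>R\<close>; replacing
    \<open>T (R h)\<close> by \<open>P h + z\<^sub>0 *\<^sub>C R h\<close> exhibits it as a
    continuous preimage of \<open>gr\<Gamma>\<close>.\<close>
  define V where "V = {v. (R (fst v), P (fst v) + z\<^sub>0 *\<^sub>C R (fst v), snd v) \<in> gr\<Gamma>}"
  have V: "(h, u) \<in> V \<longleftrightarrow> u = \<Gamma> (R h)" for h u
    using R(2) by (auto simp: V_def gr\<Gamma>_def TR)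
  have "csubspace V"
    unfolding complex_vector.subspace_def
  proof (intro conjI ballI allI)
    show "0 \<in> V"
      by (simp add: zero_prod_def[where 'b="'k \<times> 'k" and 'a='h] V blinfun.zero_right)
  next
    fix v w assume vw: "v \<in> V" "w \<in> V"
    obtain h u h' u' where [simp]: "v = (h, u)" "w = (h', u')" by (cases v, cases w)
    show "v + w \<in> V"
      using vw R(2) by (simp add: V blinfun.add_right \<Gamma>_simps)
  next
    fix c v assume v: "v \<in> V"
    obtain h u where [simp]: "v = (h, u)" by (cases v)
    show "c *\<^sub>C v \<in> V"
      using v R(2) by (simp add: V scaleC_Pair[of c h u] clinear_onD(2)[OF R(1)] \<Gamma>_simps)
  qed
  moreover have "closed V"
    unfolding V_def by (intro closed_Collect_mem[OF closed_gr\<Gamma>] continuous_intros)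
  moreover have "\<exists>!u. (h, u) \<in> V" for h
    by (simp add: V)
  ultimately obtain Q :: "'h \<Rightarrow>\<^sub>L ('k \<times> 'k)" where Q: "clinear_on UNIV (blinfun_apply Q)"
      "\<And>h u. (h, u) \<in> V \<longleftrightarrow> u = Q h"
    by (rule cclosed_graph) blast
  have QR: "Q h = \<Gamma> (R h)" for h
    using Q(2)[of h "Q h"] by (simp add: V)
  obtain U G H where U: "open U" "z\<^sub>0 \<in> U" and G: "analytic_family_on G U"
      "\<And>z. z \<in> U \<Longrightarrow> G z \<in> bounded_ops \<and> invertible_op (G z)"
      "\<And>z u. z \<in> U \<Longrightarrow> G z u = u + (z - z\<^sub>0) *\<^sub>C Q (H z (E u))"
    and HR: "\<And>z x. z \<in> U \<Longrightarrow> H z x - (z - z\<^sub>0) *\<^sub>C R (H z x) = x"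
    and HL: "\<And>z x. z \<in> U \<Longrightarrow> H z (x - (z - z\<^sub>0) *\<^sub>C R x) = x"
    by (rule analytic_perturbation_family[OF R(1) Q(1) E(1)]) blast
  have G0: "G z\<^sub>0 = id_blinfun"
    by (rule blinfun_eqI) (simp add: G(3)[OF U(2)])
  have LD: "f \<in> D" "T f = z\<^sub>0 *\<^sub>C f" "f \<in> A" if "f \<in> ?L" for f
    using that by (simp_all add: N_def)
  have GH: "G z (\<Gamma> f) = \<Gamma> (H z f)" if z: "z \<in> U" and f: "f \<in> ?L" for z f
  proof -
    have "H z f = f + (z - z\<^sub>0) *\<^sub>C R (H z f)"
      using HR[OF z, of f] by (simp add: diff_eq_eq)
    then have "\<Gamma> (H z f) = \<Gamma> (f + (z - z\<^sub>0) *\<^sub>C R (H z f))"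
      by simp
    also have "\<dots> = \<Gamma> f + (z - z\<^sub>0) *\<^sub>C \<Gamma> (R (H z f))"
      using LD(1)[OF f] R(2) by (simp add: \<Gamma>_simps D_simps)
    finally show ?thesis
      by (simp add: G(3)[OF z] E(2)[OF f] QR)
  qed
  \<comment> \<open>Restriction to \<open>A\<close> loses no boundary values, as \<Gamma>
    annihilates the discarded component.\<close>
  have \<Gamma>N: "\<Gamma> ` N z\<^sub>0 = \<Gamma> ` ?L"
  proof (intro equalityI subsetI)
    fix u assume "u \<in> \<Gamma> ` N z\<^sub>0"
    then obtain f where f: "f \<in> N z\<^sub>0" "u = \<Gamma> f" by blast
    define n where "n = f - P f"
    have n: "n \<in> N z\<^sub>0" "\<Gamma> n = 0"
      using orthogonal_A[of n] P(3) by (simp_all add: n_def cinner_eq_0_sym)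
    have Pf: "P f = f - n" by (simp add: n_def)
    have "P f \<in> N z\<^sub>0"
      unfolding Pf by (rule complex_vector.subspace_diff[OF csubspace_N f(1) n(1)])
    moreover have "\<Gamma> (P f) = u"
      unfolding Pf using f n by (simp add: \<Gamma>_simps(3) N_def)
    ultimately show "u \<in> \<Gamma> ` ?L"
      using P(2) by blast
  qed blast
  have "blinfun_apply (G z) ` \<Gamma> ` N z\<^sub>0 = \<Gamma> ` N z" if z: "z \<in> U" for z
  proof (cases "z = z\<^sub>0")
    \<comment> \<open>At \<open>z\<^sub>0\<close> the kernel may be larger than \<open>?L\<close>,
      so this point is settled by \<open>G z\<^sub>0\<close> being the identity.\<close>
    case True
    then show ?thesis by (simp add: G0)
  next
    case False
    have "H z ` ?L = N z"
    proof (intro equalityI subsetI)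
      fix g assume "g \<in> H z ` ?L"
      then obtain f where f: "f \<in> ?L" "g = H z f" by blast
      have g: "g = f + (z - z\<^sub>0) *\<^sub>C R g"
        using HR[OF z, of f] by (simp add: diff_eq_eq f(2))
      \<comment> \<open>\<open>R\<close> takes values in \<open>A\<close>, so the fixed point
        equation places \<open>g\<close> in \<open>A\<close>; there \<open>P g = g\<close>, which
        evaluates \<open>T (R g)\<close>.\<close>
      have mem: "f + (z - z\<^sub>0) *\<^sub>C R g \<in> D" "f + (z - z\<^sub>0) *\<^sub>C R g \<in> A"
        using LD[OF f(1)] R(2,4) complex_vector.subspace_add[OF csubspace_A]
          complex_vector.subspace_scale[OF csubspace_A] by (auto simp: D_simps)
      have gDA: "g \<in> D" "g \<in> A"
        using mem g by simp_all
      have "T g = T (f + (z - z\<^sub>0) *\<^sub>C R g)"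
        using g by simp
      also have "\<dots> = z\<^sub>0 *\<^sub>C (f + (z - z\<^sub>0) *\<^sub>C R g) + (z - z\<^sub>0) *\<^sub>C g"
        using LD[OF f(1)] R(2) P(4)[OF gDA(2)]
        by (simp add: T_simps D_simps TR scaleC_add_right scaleC_scaleC mult.commute)
      also have "\<dots> = z *\<^sub>C g"
        using g by (simp flip: scaleC_add_left)
      finally show "g \<in> N z"
        using gDA by (simp add: N_def)
    next
      fix g assume "g \<in> N z"
      then have g: "g \<in> D" "T g = z *\<^sub>C g"
        by (simp_all add: N_def)
      \<comment> \<open>Division by \<open>z - z\<^sub>0\<close> shows that the kernel of
        \<open>T - z\<close> lies in the range \<open>A\<close>; this is where
        \<open>z \<noteq> z\<^sub>0\<close> enters.\<close>
      have "inverse (z - z\<^sub>0) *\<^sub>C (T g - z\<^sub>0 *\<^sub>C g) = g"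
        using False by (simp add: g(2) scaleC_scaleC scaleC_one flip: scaleC_diff_left)
      moreover have "T g - z\<^sub>0 *\<^sub>C g \<in> A"
        using g(1) by (auto simp: A_def)
      ultimately have gA: "g \<in> A"
        using complex_vector.subspace_scale[OF csubspace_A] by metis
      define f where "f = g - (z - z\<^sub>0) *\<^sub>C R g"
      have "f \<in> A"
        unfolding f_def using gA R(4)
        by (intro complex_vector.subspace_diff[OF csubspace_A] complex_vector.subspace_scale[OF csubspace_A])
      moreover have "T f = z\<^sub>0 *\<^sub>C f"
      proof -
        have "T f = z *\<^sub>C g - (z - z\<^sub>0) *\<^sub>C (g + z\<^sub>0 *\<^sub>C R g)"
          using g R(2) P(4)[OF gA] by (simp add: f_def T_simps D_simps TR)
        also have "\<dots> = z\<^sub>0 *\<^sub>C f"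
          by (simp add: f_def scaleC_add_right scaleC_diff_right scaleC_diff_left scaleC_scaleC
              right_diff_distrib left_diff_distrib mult.commute)
        finally show ?thesis .
      qed
      ultimately have "f \<in> ?L"
        using g(1) R(2) by (simp add: N_def f_def D_simps)
      moreover have "H z f = g"
        unfolding f_def by (rule HL[OF z])
      ultimately show "g \<in> H z ` ?L" by blast
    qed
    then have "\<Gamma> ` N z = \<Gamma> ` H z ` ?L" by simp
    also have "\<dots> = blinfun_apply (G z) ` \<Gamma> ` ?L"
      using GH[OF z] by (simp add: image_image)
    finally show ?thesis
      by (simp add: \<Gamma>N)
  qed
  then show thesis
    using that[OF U G(1,2) G0] by blast
qed

end

section \<open>The adjoint, and the passage from boundary triplets to boundary maps\<close>

lemma orthogonal_dense_eq_0:
  assumes "closure X = UNIV" "\<And>f. f \<in> X \<Longrightarrow> cinner d f = 0"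
  shows "d = 0"
proof -
  have "closed {f. cinner d f = 0}"
    by (intro closed_Collect_eq continuous_intros)
  then have "closure X \<subseteq> {f. cinner d f = 0}"
    using assms(2) by (intro closure_minimal) auto
  then have "cinner d d = 0"
    unfolding assms(1) by blast
  then show ?thesis by simp
qed

text \<open>Density makes the vector in the definition of the adjoint unique. Domain and value merge
  into one condition, from which linearity and closedness of the adjoint can be read off.\<close>

lemma adj_op_iff:
  assumes "densely_defined S"
  shows "g \<in> op_dom (adj_op S) \<and> h = op_app (adj_op S) g \<longleftrightarrow>
    (\<forall>f\<in>op_dom S. cinner g (op_app S f) = cinner h f)"
proof -
  have uniq: "h = h'" if "\<forall>f\<in>op_dom S. cinner g (op_app S f) = cinner h f"
    "\<forall>f\<in>op_dom S. cinner g (op_app S f) = cinner h' f" for h h'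
  proof -
    have "h - h' = 0"
      by (rule orthogonal_dense_eq_0[of "op_dom S"])
        (use that assms in \<open>simp_all add: densely_defined_def cinner_diff_left\<close>)
    then show ?thesis by simp
  qed
  have the: "op_app (adj_op S) g = h" if "\<forall>f\<in>op_dom S. cinner g (op_app S f) = cinner h f" for h
    using that uniq unfolding adj_op_def snd_conv by (intro the_equality) blast+
  show ?thesis
  proof
    assume "g \<in> op_dom (adj_op S) \<and> h = op_app (adj_op S) g"
    then obtain h' where h': "\<forall>f\<in>op_dom S. cinner g (op_app S f) = cinner h' f" "h = op_app (adj_op S) g"
      by (auto simp: adj_op_def)
    then have "h = h'"
      using the by simp
    then show "\<forall>f\<in>op_dom S. cinner g (op_app S f) = cinner h f"
      using h'(1) by simp
  next
    assume h: "\<forall>f\<in>op_dom S. cinner g (op_app S f) = cinner h f"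
    then have "g \<in> op_dom (adj_op S)"
      by (auto simp: adj_op_def)
    then show "g \<in> op_dom (adj_op S) \<and> h = op_app (adj_op S) g"
      using the[OF h] by simp
  qed
qed

lemma boundary_triplet_boundary_map:
  fixes S :: "'h::chilbert_space lop" and \<Gamma>\<^sub>0 \<Gamma>\<^sub>1 :: "'h \<Rightarrow> 'k::chilbert_space"
  assumes dense: "densely_defined S" and sym: "symmetric_op S"
    and triplet: "boundary_triplet S \<Gamma>\<^sub>0 \<Gamma>\<^sub>1" and z\<^sub>0: "z\<^sub>0 \<in> Phi_minus (adj_op S)"
  shows "boundary_map (op_dom (adj_op S)) (op_app (adj_op S)) (\<lambda>f. (\<Gamma>\<^sub>0 f, \<Gamma>\<^sub>1 f)) z\<^sub>0"
proof -
  let ?D = "op_dom (adj_op S)" and ?T = "op_app (adj_op S)"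
  note adj = adj_op_iff[OF dense]
  have T: "cinner g (op_app S f) = cinner (?T g) f" if "g \<in> ?D" "f \<in> op_dom S" for f g
    using adj[of g "?T g"] that by blast
  have add: "f + g \<in> ?D \<and> ?T f + ?T g = ?T (f + g)" if "f \<in> ?D" "g \<in> ?D" for f g
    unfolding adj using T[OF that(1)] T[OF that(2)] by (simp add: cinner_add_left)
  have scale: "c *\<^sub>C f \<in> ?D \<and> c *\<^sub>C ?T f = ?T (c *\<^sub>C f)" if "f \<in> ?D" for c f
    unfolding adj using T[OF that] by (simp add: cinner_scaleC_left)
  have S_sub: "f \<in> ?D \<and> op_app S f = ?T f" if "f \<in> op_dom S" for f
    unfolding adj using sym that by (simp add: symmetric_op_def)
  show ?thesis
  proof
    have "0 \<in> ?D \<and> 0 = ?T 0"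
      unfolding adj by simp
    then show "csubspace ?D"
      using add scale by (auto simp: complex_vector.subspace_def)
    show "clinear_on ?D ?T"
      using add scale by (simp add: clinear_on_def)
    show "clinear_on ?D (\<lambda>f. (\<Gamma>\<^sub>0 f, \<Gamma>\<^sub>1 f))"
      using triplet by (simp add: boundary_triplet_def clinear_on_def)
    show "closed {v. fst v \<in> ?D \<and> snd v = ?T (fst v)}"
      unfolding adj by (intro closed_Collect_ball closed_Collect_eq continuous_intros)
    show "(\<lambda>f. (\<Gamma>\<^sub>0 f, \<Gamma>\<^sub>1 f)) ` ?D = UNIV"
      using triplet by (simp add: boundary_triplet_def)
    show "cinner f (?T g) - cinner (?T f) g = boundary_form (\<Gamma>\<^sub>0 f, \<Gamma>\<^sub>1 f) (\<Gamma>\<^sub>0 g, \<Gamma>\<^sub>1 g)"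
      if "f \<in> ?D" "g \<in> ?D" for f g
      using triplet that by (simp add: boundary_triplet_def boundary_form_def)
    show "n \<in> ?D \<and> ?T n = cnj z *\<^sub>C n"
      if n: "\<And>g. g \<in> ?D \<Longrightarrow> cinner n (?T g - z *\<^sub>C g) = 0" for z n
    proof -
      have "\<forall>f\<in>op_dom S. cinner n (op_app S f) = cinner (cnj z *\<^sub>C n) f"
        using n S_sub by (simp add: cinner_diff_right cinner_scaleC_right cinner_scaleC_left)
      then show ?thesis
        using adj[of n "cnj z *\<^sub>C n"] by simp
    qed
    have ran: "op_ran (shift_op (adj_op S) z\<^sub>0) = (\<lambda>f. ?T f - z\<^sub>0 *\<^sub>C f) ` ?D"
      by (simp add: op_ran_def shift_op_def)
    have "codimension (op_ran (shift_op (adj_op S) z\<^sub>0)) \<noteq> \<infinity>"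
      using z\<^sub>0 by (simp add: Phi_minus_def deficiency_def)
    \<comment> \<open>The infimum of the empty set is \<open>\<infinity>\<close>, so a codimension
      other than \<open>\<infinity>\<close> supplies a finite \<open>B\<close>.\<close>
    then have "{enat (card B) |B. finite B \<and> cspan (op_ran (shift_op (adj_op S) z\<^sub>0) \<union> B) = UNIV} \<noteq> {}"
      unfolding codimension_def by (metis Inf_enat_def)
    then show "\<exists>B. finite B \<and> cspan ((\<lambda>f. ?T f - z\<^sub>0 *\<^sub>C f) ` ?D \<union> B) = UNIV"
      unfolding ran by auto
  qed
qed

theorem theorem4p1:
  fixes S :: "'h :: chilbert_space lop"
    and \<Gamma>\<^sub>0 \<Gamma>\<^sub>1 :: "'h \<Rightarrow> 'k :: chilbert_space"
    and z\<^sub>0 :: complex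
  assumes "separable_space (euclidean :: 'h topology)"
    and "linear_op S" and "closed_op S" and "densely_defined S" and "symmetric_op S"
    and "equal_defect_numbers S"
    and "boundary_triplet S \<Gamma>\<^sub>0 \<Gamma>\<^sub>1"
    and "z\<^sub>0 \<in> Phi_minus (adj_op S)"
  shows "\<exists>U. open U \<and> z\<^sub>0 \<in> U \<and>
    (\<exists>G :: complex \<Rightarrow> ('k \<times> 'k) \<Rightarrow>\<^sub>L ('k \<times> 'k).
      analytic_family_on G U \<and>
      (\<forall>z\<in>U. G z \<in> bounded_ops \<and> invertible_op (G z)) \<and>
      G z\<^sub>0 = id_blinfun \<and>
      (\<forall>z\<in>U. blinfun_apply (G z) ` boundary_space S \<Gamma>\<^sub>0 \<Gamma>\<^sub>1 z\<^sub>0 = boundary_space S \<Gamma>\<^sub>0 \<Gamma>\<^sub>1 z))"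
proof -
  interpret boundary_map "op_dom (adj_op S)" "op_app (adj_op S)" "\<lambda>f. (\<Gamma>\<^sub>0 f, \<Gamma>\<^sub>1 f)" z\<^sub>0
    using assms by (intro boundary_triplet_boundary_map)
  have M: "boundary_space S \<Gamma>\<^sub>0 \<Gamma>\<^sub>1 z = (\<lambda>f. (\<Gamma>\<^sub>0 f, \<Gamma>\<^sub>1 f)) ` N z" for z
    by (auto simp: boundary_space_def op_ker_def shift_op_def N_def)
  obtain U G where "open U" "z\<^sub>0 \<in> U" "analytic_family_on G U"
    "\<And>z. z \<in> U \<Longrightarrow> G z \<in> bounded_ops \<and> invertible_op (G z)"
    "G z\<^sub>0 = id_blinfun"
    "\<And>z. z \<in> U \<Longrightarrow> blinfun_apply (G z) ` (\<lambda>f. (\<Gamma>\<^sub>0 f, \<Gamma>\<^sub>1 f)) ` N z\<^sub>0 = (\<lambda>f. (\<Gamma>\<^sub>0 f, \<Gamma>\<^sub>1 f)) ` N z"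
    by (rule analytic_boundary_family) blast
  then show ?thesis
    unfolding M by (intro exI[of _ U] exI[of _ G] conjI ballI) simp_all
qed

end
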